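(* Let $r\ge 1$ and let $\mu_1,\ldots,\mu_r$ be measures that are absolutely continuous with weights $w_1,\ldots,w_r$, i.e. $d\mu_k(t)=w_k(t)\,dt$, such that each $w_k$ vanishes at the endpoints of the support of $\mu_k$. Suppose that all multi-indices $\vec n=(n_1,\ldots,n_r)\in\mathbb N^r$ are normal and that for every $\vec n$ the functions $$\{w_1,xw_1,\ldots,x^{n_1-1}w_1,\;w_2,xw_2,\ldots,x^{n_2-1}w_2,\;\ldots,\;w_r,xw_r,\ldots,x^{n_r-1}w_r\}$$ are linearly independent. Let $N(\vec n;x)$ be the $(r+1)\times(r+1)$ coefficient matrix of the ladder equations $\mathbf P_{\vec n}'(x)=N(\vec n;x)\mathbf P_{\vec n}(x)$ for the type II multiple orthogonal polynomials, and let $W(\vec n+\vec e_l;x)$ be the matrix of the nearest-neighbor recurrence relations $\mathbf P_{\vec n+\vec e_l}(x)=W(\vec n+\vec e_l;x)\mathbf P_{\vec n}(x)$, both given explicitly in the context. Then, for every multi-index $\vec n$ with $n_j\ge1$ for all $j$, the following compatibility conditions for the ladder equations hold: $$N(\vec n+\vec e_l;x)\,W(\vec n+\vec e_l;x)=W'(\vec n+\vec e_l;x)+W(\vec n+\vec e_l;x)\,N(\vec n;x),\qquad l=1,\ldots,r,$$ where $'$ denotes the entrywise derivative with respect to $x$.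
   Context: The measures are supported on an oriented simple curve $\Gamma$ in the complex plane (for example an interval or the whole real line); all integrals are over $\Gamma$, with $w_k$ taken to be $0$ on $\Gamma$ off the support of $\mu_k$. The weights are assumed regular enough (differentiable, Hölder continuous, with all moments of $w_k$ and of $w_k'$ finite) for all integrals below to exist; "vanishes at the endpoints" includes, for an infinite endpoint, that $x^m w_k(x)\to 0$ for every $m\geq 0$. Put $v_k=-\ln w_k$, so $v_k'=-w_k'/w_k$; identities are understood at points $x$ at which $v_1',\ldots,v_r'$ are all defined (possibly by continuation off the support) and the integrals converge. Notation: $|\vec n|=n_1+\cdots+n_r$; $\vec e_j$ is the $j$-th standard unit vector of $\mathbb N^r$ and $\vec e_0=\vec 0$. Type I multiple orthogonal polynomials: the vector $(A_{\vec n,1},\ldots,A_{\vec n,r})$ with $A_{\vec n,j}$ a polynomial of degree $\le n_j-1$ (zero if $n_j=0$) such that $\sum_{j=1}^r\int x^kA_{\vec n,j}(x)\,d\mu_j(x)=0$ for $k=0,1,\ldots,|\vec n|-2$ and $\sum_{j=1}^r\int x^{|\vec n|-1}A_{\vec n,j}(x)\,d\mu_j(x)=1$. Put $Q_{\vec n}(x)=\sum_{j=1}^rA_{\vec n,j}(x)w_j(x)$. Type II multiple orthogonal polynomial: the monic polynomial $P_{\vec n}$ of degree $|\vec n|$ such that $\int P_{\vec n}(x)x^k\,d\mu_j(x)=0$ for $k=0,\ldots,n_j-1$ and $j=1,\ldots,r$. Normal index: $\vec n$ is normal if the $|\vec n|\times|\vec n|$ matrix of mixed moments of the linear system defining the type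 I polynomials is nonsingular; its columns are $\left(\nu^{(j)}_{s},\ldots,\nu^{(j)}_{s+|\vec n|-1}\right)^T$ for $s=0,\ldots,n_j-1$, $j=1,\ldots,r$, where $\nu^{(j)}_m=\int x^m\,d\mu_j(x)$. For a normal index both the type I vector and $P_{\vec n}$ exist and are unique. Recurrence coefficients: $$a_{\vec n,j}=\frac{\int x^{n_j}P_{\vec n}(x)\,d\mu_j(x)}{\int x^{n_j-1}P_{\vec n-\vec e_j}(x)\,d\mu_j(x)}\ (n_j\ge1),\qquad b_{\vec n,j}=\int xP_{\vec n}(x)Q_{\vec n+\vec e_j}(x)\,dx,\qquad j=1,\ldots,r.$$ The nearest-neighbor recurrence relations are $xP_{\vec n}(x)=P_{\vec n+\vec e_l}(x)+b_{\vec n,l}P_{\vec n}(x)+\sum_{j=1}^ra_{\vec n,j}P_{\vec n-\vec e_j}(x)$, $l=1,\ldots,r$. Let $\mathbf P_{\vec n}(x)=(P_{\vec n}(x),P_{\vec n-\vec e_1}(x),\ldots,P_{\vec n-\vec e_r}(x))^T$. Matrix $N(\vec n;x)=(N_{ij}(x))_{0\le i,j\le r}$: for $0\le i\le r$, $$N_{i0}(x)=\int P_{\vec n-\vec e_i}(t)\sum_{k=1}^rA_{\vec n,k}(t)\frac{v_k'(t)-v_k'(x)}{x-t}w_k(t)\,dt,$$ and for $1\le j\le r$, $$N_{ij}(x)=a_{\vec n,j}\int P_{\vec n-\vec e_i}(t)\sum_{k=1}^rA_{\vec n+\vec e_j,k}(t)\frac{v_k'(t)-v_k'(x)}{t-x}w_k(t)\,dt+v_i'(x)\delta_{i,j}$$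 (the last term being absent for $i=0$), where $\delta_{i,j}$ is the Kronecker delta. Matrix $W(\vec n+\vec e_l;x)$, with rows and columns indexed by $0,1,\ldots,r$: row $0$ is $(x-b_{\vec n,l},-a_{\vec n,1},\ldots,-a_{\vec n,r})$; for $1\le j\le r$, row $j$ has entry $1$ in column $0$, entry $B_{l,j}(\vec n)=b_{\vec n-\vec e_j,j}-b_{\vec n-\vec e_j,l}$ in column $j$ (so this entry is $0$ for $j=l$), and $0$ elsewhere. *)

theory Defs
  imports "HOL-Analysis.Analysis" "Jordan_Normal_Form.Determinant"
begin

text \<open>A curve is given by a closed parameter interval \<open>I\<close> and a map \<open>\<gamma>\<close>.
  An infinite end of the curve is parametrized over an infinite end of \<open>I\<close>. The only coincidence
  that simplicity admits is that of the two ends of a bounded \<open>I\<close> (a closed curve).\<close>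

definition oriented_simple_curve :: "real set \<Rightarrow> (real \<Rightarrow> complex) \<Rightarrow> bool" where
  "oriented_simple_curve I \<gamma> \<longleftrightarrow>
     is_interval I \<and> closed I \<and> interior I \<noteq> {} \<and>
     \<gamma> piecewise_C1_differentiable_on I \<and>
     (\<forall>s\<in>I. \<forall>t\<in>I. \<gamma> s = \<gamma> t \<longrightarrow> s = t \<or> I = closed_segment s t) \<and>
     (\<not> bdd_above I \<longrightarrow> filterlim \<gamma> at_infinity at_top) \<and>
     (\<not> bdd_below I \<longrightarrow> filterlim \<gamma> at_infinity at_bot)"

definition curve_integrable :: "real set \<Rightarrow> (real \<Rightarrow> complex) \<Rightarrow> (complex \<Rightarrow> complex) \<Rightarrow> bool" where
  "curve_integrable I \<gamma> f \<longleftrightarrow>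
     set_integrable lebesgue I (\<lambda>s. f (\<gamma> s) * vector_derivative \<gamma> (at s within I))"

definition curve_integral :: "real set \<Rightarrow> (real \<Rightarrow> complex) \<Rightarrow> (complex \<Rightarrow> complex) \<Rightarrow> complex" where
  "curve_integral I \<gamma> f =
     (LINT s:I|lebesgue. f (\<gamma> s) * vector_derivative \<gamma> (at s within I))"

text \<open>Derivative along the curve: the difference quotient is restricted to points of \<open>\<Gamma>\<close>.\<close>

definition deriv_along :: "complex set \<Rightarrow> (complex \<Rightarrow> complex) \<Rightarrow> complex \<Rightarrow> complex" where
  "deriv_along \<Gamma> f z = (THE D. (f has_field_derivative D) (at z within \<Gamma>))"

definition weight_support :: "complex set \<Rightarrow> (complex \<Rightarrow> complex) \<Rightarrow> complex set" where
  "weight_support \<Gamma> f = closure {z \<in> \<Gamma>. f z \<noteq> 0}"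

text \<open>Finite endpoints of the support: its boundary points relative to the curve, together with
  the finite ends of the curve that lie in it. A closed curve (\<open>\<gamma>\<close> not injective) has no ends.\<close>

definition support_endpoints :: "real set \<Rightarrow> (real \<Rightarrow> complex) \<Rightarrow> (complex \<Rightarrow> complex) \<Rightarrow> complex set" where
  "support_endpoints I \<gamma> f =
     {z \<in> weight_support (\<gamma> ` I) f.
        z \<in> closure (\<gamma> ` I - weight_support (\<gamma> ` I) f) \<or> (inj_on \<gamma> I \<and> z \<in> \<gamma> ` frontier I)}"

definition locally_Hoelder_on :: "complex set \<Rightarrow> (complex \<Rightarrow> complex) \<Rightarrow> bool" where
  "locally_Hoelder_on \<Gamma> f \<longleftrightarrow>
     (\<forall>z\<in>\<Gamma>. \<exists>e>0. \<exists>C. \<exists>\<alpha>>0. \<alpha> \<le> 1 \<and>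
        (\<forall>s\<in>\<Gamma> \<inter> ball z e. \<forall>t\<in>\<Gamma> \<inter> ball z e. dist (f s) (f t) \<le> C * dist s t powr \<alpha>))"

text \<open>Differentiability is not required at the endpoints of the support, so that for instance
  \<open>(t * (1 - t)) powr \<alpha>\<close> on \<open>[0,1]\<close> with \<open>0 < \<alpha> < 1\<close> is admitted.\<close>

definition regular_weight :: "real set \<Rightarrow> (real \<Rightarrow> complex) \<Rightarrow> (complex \<Rightarrow> complex) \<Rightarrow> bool" where
  "regular_weight I \<gamma> f \<longleftrightarrow>
     locally_Hoelder_on (\<gamma> ` I) f \<and>
     finite (support_endpoints I \<gamma> f) \<and>
     (\<forall>z\<in>weight_support (\<gamma> ` I) f - support_endpoints I \<gamma> f.
        f field_differentiable (at z within \<gamma> ` I)) \<and>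
     (\<forall>m. curve_integrable I \<gamma> (\<lambda>t. t ^ m * f t)) \<and>
     (\<forall>m. curve_integrable I \<gamma> (\<lambda>t. t ^ m * deriv_along (\<gamma> ` I) f t))"

definition vanishes_at_endpoints :: "real set \<Rightarrow> (real \<Rightarrow> complex) \<Rightarrow> (complex \<Rightarrow> complex) \<Rightarrow> bool" where
  "vanishes_at_endpoints I \<gamma> f \<longleftrightarrow>
     (\<forall>z\<in>support_endpoints I \<gamma> f. f z = 0) \<and>
     (\<not> bdd_above I \<longrightarrow> (\<forall>m. ((\<lambda>s. \<gamma> s ^ m * f (\<gamma> s)) \<longlongrightarrow> 0) at_top)) \<and>
     (\<not> bdd_below I \<longrightarrow> (\<forall>m. ((\<lambda>s. \<gamma> s ^ m * f (\<gamma> s)) \<longlongrightarrow> 0) at_bot))"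

text \<open>A multi-index is a function of which only the values at \<open>1, \<dots>, r\<close> matter;
  \<open>up n j\<close> and \<open>down n j\<close> are \<open>n + e\<^sub>j\<close> and \<open>n - e\<^sub>j\<close>, where \<open>e\<^sub>0 = 0\<close>.\<close>

definition mi_size :: "nat \<Rightarrow> (nat \<Rightarrow> nat) \<Rightarrow> nat" where
  "mi_size r n = (\<Sum>j=1..r. n j)"

definition up :: "(nat \<Rightarrow> nat) \<Rightarrow> nat \<Rightarrow> (nat \<Rightarrow> nat)" where
  "up n j = (if j = 0 then n else n(j := n j + 1))"

definition down :: "(nat \<Rightarrow> nat) \<Rightarrow> nat \<Rightarrow> (nat \<Rightarrow> nat)" where
  "down n j = (if j = 0 then n else n(j := n j - 1))"

definition moment :: "real set \<Rightarrow> (real \<Rightarrow> complex) \<Rightarrow> (complex \<Rightarrow> complex) \<Rightarrow> nat \<Rightarrow> complex" where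
  "moment I \<gamma> f m = curve_integral I \<gamma> (\<lambda>t. t ^ m * f t)"

definition moment_matrix ::
  "real set \<Rightarrow> (real \<Rightarrow> complex) \<Rightarrow> nat \<Rightarrow> (nat \<Rightarrow> complex \<Rightarrow> complex) \<Rightarrow> (nat \<Rightarrow> nat) \<Rightarrow> complex mat" where
  "moment_matrix I \<gamma> r w n =
     mat_of_cols (mi_size r n)
       (concat (map (\<lambda>j. map (\<lambda>s. Matrix.vec (mi_size r n) (\<lambda>i. moment I \<gamma> (w j) (s + i))) [0..<n j])
                    [1..<Suc r]))"

definition normal_index ::
  "real set \<Rightarrow> (real \<Rightarrow> complex) \<Rightarrow> nat \<Rightarrow> (nat \<Rightarrow> complex \<Rightarrow> complex) \<Rightarrow> (nat \<Rightarrow> nat) \<Rightarrow> bool" where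
  "normal_index I \<gamma> r w n \<longleftrightarrow> Determinant.det (moment_matrix I \<gamma> r w n) \<noteq> 0"

definition weights_lin_indep :: "complex set \<Rightarrow> nat \<Rightarrow> (nat \<Rightarrow> complex \<Rightarrow> complex) \<Rightarrow> (nat \<Rightarrow> nat) \<Rightarrow> bool" where
  "weights_lin_indep \<Gamma> r w n \<longleftrightarrow>
     (\<forall>c :: nat \<Rightarrow> nat \<Rightarrow> complex.
        (\<forall>z\<in>\<Gamma>. (\<Sum>j=1..r. \<Sum>s<n j. c j s * (z ^ s * w j z)) = 0) \<longrightarrow>
        (\<forall>j\<in>{1..r}. \<forall>s<n j. c j s = 0))"

text \<open>Components outside \<open>1, \<dots>, r\<close> are fixed to be 0 so that the vector is unique as a function.
  The zero multi-index has no normalization condition, and its type I vector is 0.\<close>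

definition is_type_I ::
  "real set \<Rightarrow> (real \<Rightarrow> complex) \<Rightarrow> nat \<Rightarrow> (nat \<Rightarrow> complex \<Rightarrow> complex) \<Rightarrow> (nat \<Rightarrow> nat)
     \<Rightarrow> (nat \<Rightarrow> complex poly) \<Rightarrow> bool" where
  "is_type_I I \<gamma> r w n A \<longleftrightarrow>
     (\<forall>j\<in>{1..r}. A j = 0 \<or> degree (A j) < n j) \<and> (\<forall>j. j \<notin> {1..r} \<longrightarrow> A j = 0) \<and>
     (\<forall>k. k + 2 \<le> mi_size r n \<longrightarrow>
        (\<Sum>j=1..r. curve_integral I \<gamma> (\<lambda>t. t ^ k * poly (A j) t * w j t)) = 0) \<and>
     (mi_size r n \<ge> 1 \<longrightarrow>
        (\<Sum>j=1..r. curve_integral I \<gamma> (\<lambda>t. t ^ (mi_size r n - 1) * poly (A j) t * w j t)) = 1)"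

definition type_I ::
  "real set \<Rightarrow> (real \<Rightarrow> complex) \<Rightarrow> nat \<Rightarrow> (nat \<Rightarrow> complex \<Rightarrow> complex) \<Rightarrow> (nat \<Rightarrow> nat)
     \<Rightarrow> nat \<Rightarrow> complex poly" where
  "type_I I \<gamma> r w n = (THE A. is_type_I I \<gamma> r w n A)"

definition type_I_Q ::
  "real set \<Rightarrow> (real \<Rightarrow> complex) \<Rightarrow> nat \<Rightarrow> (nat \<Rightarrow> complex \<Rightarrow> complex) \<Rightarrow> (nat \<Rightarrow> nat)
     \<Rightarrow> complex \<Rightarrow> complex" where
  "type_I_Q I \<gamma> r w n x = (\<Sum>j=1..r. poly (type_I I \<gamma> r w n j) x * w j x)"

definition is_type_II ::
  "real set \<Rightarrow> (real \<Rightarrow> complex) \<Rightarrow> nat \<Rightarrow> (nat \<Rightarrow> complex \<Rightarrow> complex) \<Rightarrow> (nat \<Rightarrow> nat)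
     \<Rightarrow> complex poly \<Rightarrow> bool" where
  "is_type_II I \<gamma> r w n P \<longleftrightarrow>
     degree P = mi_size r n \<and> lead_coeff P = 1 \<and>
     (\<forall>j\<in>{1..r}. \<forall>k<n j. curve_integral I \<gamma> (\<lambda>t. poly P t * t ^ k * w j t) = 0)"

definition type_II ::
  "real set \<Rightarrow> (real \<Rightarrow> complex) \<Rightarrow> nat \<Rightarrow> (nat \<Rightarrow> complex \<Rightarrow> complex) \<Rightarrow> (nat \<Rightarrow> nat)
     \<Rightarrow> complex poly" where
  "type_II I \<gamma> r w n = (THE P. is_type_II I \<gamma> r w n P)"

definition rec_a ::
  "real set \<Rightarrow> (real \<Rightarrow> complex) \<Rightarrow> nat \<Rightarrow> (nat \<Rightarrow> complex \<Rightarrow> complex) \<Rightarrow> (nat \<Rightarrow> nat)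
     \<Rightarrow> nat \<Rightarrow> complex" where
  "rec_a I \<gamma> r w n j =
     curve_integral I \<gamma> (\<lambda>t. t ^ n j * poly (type_II I \<gamma> r w n) t * w j t) /
     curve_integral I \<gamma> (\<lambda>t. t ^ (n j - 1) * poly (type_II I \<gamma> r w (down n j)) t * w j t)"

definition rec_b ::
  "real set \<Rightarrow> (real \<Rightarrow> complex) \<Rightarrow> nat \<Rightarrow> (nat \<Rightarrow> complex \<Rightarrow> complex) \<Rightarrow> (nat \<Rightarrow> nat)
     \<Rightarrow> nat \<Rightarrow> complex" where
  "rec_b I \<gamma> r w n j =
     curve_integral I \<gamma> (\<lambda>t. t * poly (type_II I \<gamma> r w n) t * type_I_Q I \<gamma> r w (up n j) t)"

text \<open>In the ladder matrix, \<open>v'\<close> is the family of functions \<open>v\<^sub>k'\<close>, including their continuation to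
  points where \<open>w\<^sub>k\<close> is 0.\<close>

definition ladder_integrand ::
  "real set \<Rightarrow> (real \<Rightarrow> complex) \<Rightarrow> nat \<Rightarrow> (nat \<Rightarrow> complex \<Rightarrow> complex) \<Rightarrow> (nat \<Rightarrow> complex \<Rightarrow> complex)
     \<Rightarrow> (nat \<Rightarrow> nat) \<Rightarrow> complex \<Rightarrow> nat \<Rightarrow> nat \<Rightarrow> complex \<Rightarrow> complex" where
  "ladder_integrand I \<gamma> r w v' n x i j t =
     poly (type_II I \<gamma> r w (down n i)) t *
     (\<Sum>k=1..r. poly (type_I I \<gamma> r w (up n j) k) t *
        ((v' k t - v' k x) / (if j = 0 then x - t else t - x)) * w k t)"

definition ladder_integrals_converge ::
  "real set \<Rightarrow> (real \<Rightarrow> complex) \<Rightarrow> nat \<Rightarrow> (nat \<Rightarrow> complex \<Rightarrow> complex) \<Rightarrow> (nat \<Rightarrow> complex \<Rightarrow> complex)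
     \<Rightarrow> (nat \<Rightarrow> nat) \<Rightarrow> complex \<Rightarrow> bool" where
  "ladder_integrals_converge I \<gamma> r w v' n x \<longleftrightarrow>
     (\<forall>i\<le>r. \<forall>j\<le>r. curve_integrable I \<gamma> (ladder_integrand I \<gamma> r w v' n x i j))"

definition ladder_matrix ::
  "real set \<Rightarrow> (real \<Rightarrow> complex) \<Rightarrow> nat \<Rightarrow> (nat \<Rightarrow> complex \<Rightarrow> complex) \<Rightarrow> (nat \<Rightarrow> complex \<Rightarrow> complex)
     \<Rightarrow> (nat \<Rightarrow> nat) \<Rightarrow> complex \<Rightarrow> complex mat" where
  "ladder_matrix I \<gamma> r w v' n x =
     Matrix.mat (r + 1) (r + 1) (\<lambda>(i, j).
       if j = 0 then curve_integral I \<gamma> (ladder_integrand I \<gamma> r w v' n x i 0)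
       else rec_a I \<gamma> r w n j * curve_integral I \<gamma> (ladder_integrand I \<gamma> r w v' n x i j)
            + (if i = j then v' i x else 0))"

text \<open>\<open>recurrence_matrix I \<gamma> r w n l x\<close> is \<open>W(n + e\<^sub>l; x)\<close>, which takes the vector at \<open>n\<close> to the
  vector at \<open>n + e\<^sub>l\<close>.\<close>

definition recurrence_matrix ::
  "real set \<Rightarrow> (real \<Rightarrow> complex) \<Rightarrow> nat \<Rightarrow> (nat \<Rightarrow> complex \<Rightarrow> complex)
     \<Rightarrow> (nat \<Rightarrow> nat) \<Rightarrow> nat \<Rightarrow> complex \<Rightarrow> complex mat" where
  "recurrence_matrix I \<gamma> r w n l x =
     Matrix.mat (r + 1) (r + 1) (\<lambda>(i, j).
       if i = 0 then (if j = 0 then x - rec_b I \<gamma> r w n l else - rec_a I \<gamma> r w n j)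
       else if j = 0 then 1
       else if i = j then rec_b I \<gamma> r w (down n j) j - rec_b I \<gamma> r w (down n j) l
       else 0)"

definition mat_deriv :: "(complex \<Rightarrow> complex mat) \<Rightarrow> complex \<Rightarrow> complex mat" where
  "mat_deriv M x =
     Matrix.mat (dim_row (M x)) (dim_col (M x)) (\<lambda>(i, j). deriv (\<lambda>y. M y $$ (i, j)) x)"

end

theory Submission
  imports Defs
begin

text \<open>Write \<open>p\<^sub>n = (P\<^sub>n, P\<^bsub>n-e\<^sub>1\<^esub>, \<dots>)\<close> and \<open>\<alpha>\<^sub>n = (-A\<^sub>n, a\<^bsub>n,1\<^esub> A\<^bsub>n+e\<^sub>1\<^esub>, \<dots>)\<close>. The ladder matrix is
  \<open>N(n;x) = \<integral> p\<^sub>n \<alpha>\<^sub>n (v'(t)-v'(x))/(t-x) w dt + diag(0, v'\<^sub>1(x), \<dots>)\<close>. The recurrences of both types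
  read \<open>W(t) p\<^sub>n = p\<^sub>m\<close> and \<open>\<alpha>\<^sub>m W(t) = \<alpha>\<^sub>n\<close> for \<open>m = n + e\<^sub>l\<close>, while \<open>W(x)\<close> differs from \<open>W(t)\<close> only by
  \<open>x - t\<close> in the entry \<open>(0,0)\<close>. Hence in \<open>N(m;x) W(x) - W(x) N(n;x)\<close> the main integrals cancel, and in what remains
  the factor \<open>t - x\<close> cancels the denominator: only integrals \<open>\<integral> q v' w\<close> and \<open>\<integral> q w\<close> with polynomials \<open>q\<close>
  are left. Integration by parts turns the former into \<open>\<integral> q' w\<close>, and orthogonality evaluates them all.\<close>

section \<open>Integration along a simple curve\<close>

text \<open>Differentiating the recurrence and inserting the ladder equations shows only that the
  two sides of the claim agree when applied to the single vector \<open>p_n(x)\<close>, which does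
  not determine a matrix. The identity is therefore computed entry by entry from the integral
  formulas, at one fixed \<open>x\<close> for which the integrals converge. The main integrals
  cancel because both matrix products lead to the same mixed kernel, \<open>p_m(t)\<close> times
  \<open>\<alpha>_n(t)\<close>: one expands the row vector, the other the column vector. In the
  remainder, \<open>\<integral> P_n' Q_n = |n|\<close> produces the corner entry, so the derivative
  of \<open>W\<close> appears as |m| - |n| = 1, and the numbers \<open>v_j'(x)\<close> are absorbed
  by the diagonal term. The analytic obstacle is integration by parts for weights that may fail to
  be differentiable at support endpoints, may have zeros at which \<open>v_k'\<close> is an
  arbitrary continuation, and may live on unbounded or closed curves.\<close>

lemma countable_non_limit_points:
  fixes X :: "'a :: second_countable_topology set"
  shows "countable {z \<in> X. \<not> z islimpt X}"
proof -
  obtain \<B> :: "'a set set" where B: "countable \<B>" "\<And>C. C \<in> \<B> \<Longrightarrow> open C"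
    and U: "\<And>S. open S \<Longrightarrow> \<exists>U. U \<subseteq> \<B> \<and> S = \<Union>U"
    using univ_second_countable by blast
  \<comment> \<open>A non-limit point is the only point of \<open>X\<close> in some member of the
    countable base, so it can be recovered from that member.\<close>
  have "{z \<in> X. \<not> z islimpt X} \<subseteq> (\<lambda>C. THE z. C \<inter> X = {z}) ` \<B>"
  proof
    fix z assume z: "z \<in> {z \<in> X. \<not> z islimpt X}"
    then obtain T where T: "open T" "z \<in> T" "\<And>y. y \<in> X \<Longrightarrow> y \<in> T \<Longrightarrow> y = z"
      unfolding islimpt_def by blast
    obtain U' where "U' \<subseteq> \<B>" "T = \<Union>U'" using U[OF T(1)] by blast
    with T(2) obtain C where C: "C \<in> \<B>" "z \<in> C" "C \<subseteq> T" by blast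
    have "C \<inter> X = {z}" using C T z by auto
    then show "z \<in> (\<lambda>C. THE z. C \<inter> X = {z}) ` \<B>" using C(1) by (intro image_eqI[of _ _ C]) auto
  qed
  then show ?thesis by (rule countable_subset) (simp add: B(1))
qed

lemma has_field_derivative_within_unique:
  assumes "(f has_field_derivative D) (at z within S)" "(f has_field_derivative E) (at z within S)"
    and "z islimpt S"
  shows "D = E"
proof (rule tendsto_unique)
  show "at z within S \<noteq> bot" using assms(3) by (simp add: trivial_limit_within)
qed (use assms(1,2) in \<open>simp_all add: has_field_derivative_iff\<close>)

text \<open>The description operator picks out a derivative only where it is unique, which fails at
  isolated points of \<open>\<Gamma>\<close>; this is the purpose of the limit point
  hypothesis.\<close>

lemma deriv_along_eq:
  assumes "(f has_field_derivative D) (at z within \<Gamma>)" "z islimpt \<Gamma>"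
  shows "deriv_along \<Gamma> f z = D"
  unfolding deriv_along_def
proof (rule the_equality)
  show "E = D" if "(f has_field_derivative E) (at z within \<Gamma>)" for E
    by (rule has_field_derivative_within_unique[OF that assms])
qed (rule assms(1))

section \<open>Linearity of the curve integral and null sets of parameters\<close>

lemma curve_integrable_iff:
  "curve_integrable I \<gamma> f \<longleftrightarrow>
    (\<lambda>s. f (\<gamma> s) * vector_derivative \<gamma> (at s within I)) absolutely_integrable_on I"
  by (simp add: curve_integrable_def)

lemma curve_integral_eq_integral:
  assumes "curve_integrable I \<gamma> f"
  shows "curve_integral I \<gamma> f = integral I (\<lambda>s. f (\<gamma> s) * vector_derivative \<gamma> (at s within I))"
  using assms unfolding curve_integrable_def curve_integral_def
  by (rule set_lebesgue_integral_eq_integral(2))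

lemma curve_integrable_add:
  "curve_integrable I \<gamma> f \<Longrightarrow> curve_integrable I \<gamma> g \<Longrightarrow> curve_integrable I \<gamma> (\<lambda>t. f t + g t)"
  unfolding curve_integrable_def by (simp add: ring_distribs set_integral_add)

lemma curve_integral_add:
  "curve_integrable I \<gamma> f \<Longrightarrow> curve_integrable I \<gamma> g \<Longrightarrow>
    curve_integral I \<gamma> (\<lambda>t. f t + g t) = curve_integral I \<gamma> f + curve_integral I \<gamma> g"
  unfolding curve_integrable_def curve_integral_def by (simp add: ring_distribs set_integral_add)

lemma curve_integrable_cmult:
  "curve_integrable I \<gamma> f \<Longrightarrow> curve_integrable I \<gamma> (\<lambda>t. c * f t)"
  unfolding curve_integrable_def by (auto simp: mult.assoc)

lemma curve_integral_cmult:
  "curve_integral I \<gamma> (\<lambda>t. c * f t) = c * curve_integral I \<gamma> f"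
  unfolding curve_integral_def by (auto simp: mult.assoc)

lemma curve_integrable_zero [simp]: "curve_integrable I \<gamma> (\<lambda>t. 0)"
  by (simp add: curve_integrable_def)

lemma curve_integral_zero [simp]: "curve_integral I \<gamma> (\<lambda>t. 0) = 0"
  by (simp add: curve_integral_def)

lemma curve_integrable_sum:
  "(\<And>k. k \<in> A \<Longrightarrow> curve_integrable I \<gamma> (f k)) \<Longrightarrow> curve_integrable I \<gamma> (\<lambda>t. \<Sum>k\<in>A. f k t)"
  by (induction A rule: infinite_finite_induct) (auto intro!: curve_integrable_add)

lemma curve_integral_sum:
  "(\<And>k. k \<in> A \<Longrightarrow> curve_integrable I \<gamma> (f k)) \<Longrightarrow>
    curve_integral I \<gamma> (\<lambda>t. \<Sum>k\<in>A. f k t) = (\<Sum>k\<in>A. curve_integral I \<gamma> (f k))"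
  by (induction A rule: infinite_finite_induct) (auto simp: curve_integral_add curve_integrable_sum)

lemma curve_integral_spike:
  assumes "negligible N" "\<And>s. s \<in> I - N \<Longrightarrow> g (\<gamma> s) = f (\<gamma> s)" "curve_integrable I \<gamma> f"
  shows "curve_integrable I \<gamma> g" "curve_integral I \<gamma> g = curve_integral I \<gamma> f"
proof -
  show g: "curve_integrable I \<gamma> g"
    using assms(3) unfolding curve_integrable_iff
    by (rule absolutely_integrable_spike[OF _ assms(1)]) (simp add: assms(2))
  show "curve_integral I \<gamma> g = curve_integral I \<gamma> f"
    unfolding curve_integral_eq_integral[OF g] curve_integral_eq_integral[OF assms(3)]
    by (rule integral_spike[OF assms(1)]) (simp add: assms(2))
qed

section \<open>Fibres and limit points of the curve\<close>

lemma finite_curve_fibre: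
  assumes "oriented_simple_curve I \<gamma>"
  shows "finite {s \<in> I. \<gamma> s = z}"
proof (cases "\<exists>s\<in>I. \<gamma> s = z")
  case True
  then obtain s where s: "s \<in> I" "\<gamma> s = z" by blast
  \<comment> \<open>A second parameter over the same point forces \<open>I\<close> to be the segment
    between the two, so it is an end of \<open>I\<close>.\<close>
  have "{t \<in> I. \<gamma> t = z} \<subseteq> {s, Inf I, Sup I}"
  proof
    fix t assume t: "t \<in> {t \<in> I. \<gamma> t = z}"
    then have "s = t \<or> I = closed_segment s t"
      using assms s unfolding oriented_simple_curve_def by auto
    then show "t \<in> {s, Inf I, Sup I}"
      by (auto simp: closed_segment_eq_real_ivl split: if_splits)
  qed
  then show ?thesis using finite_subset by blast
next
  case False
  then have "{t \<in> I. \<gamma> t = z} = {}" by blast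
  then show ?thesis by (simp only: finite.emptyI)
qed

lemma curve_continuous: "oriented_simple_curve I \<gamma> \<Longrightarrow> continuous_on I \<gamma>"
  by (auto simp: oriented_simple_curve_def piecewise_C1_differentiable_on_def)

lemma curve_parameter_islimpt:
  assumes "oriented_simple_curve I \<gamma>" "s \<in> I"
  shows "s islimpt I"
proof -
  obtain u where u: "u \<in> interior I" using assms by (auto simp: oriented_simple_curve_def)
  have "u islimpt I" using u interior_limit_point by blast
  moreover have "connected I" using assms by (simp add: oriented_simple_curve_def is_interval_connected)
  moreover have "I \<noteq> {t}" for t using u by auto
  ultimately show ?thesis using assms(2) by (intro connected_imp_perfect)
qed

text \<open>The fibre over \<open>\<gamma> s\<close> is finite, so parameters close to
  \<open>s\<close> have images different from \<open>\<gamma> s\<close>, and by continuity these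
  images converge to it. This makes derivatives along the curve unique.\<close>

lemma curve_point_islimpt:
  assumes c: "oriented_simple_curve I \<gamma>" and s: "s \<in> I"
  shows "\<gamma> s islimpt \<gamma> ` I"
proof -
  define F where "F = {t \<in> I. \<gamma> t = \<gamma> s}"
  have lim: "(\<gamma> \<longlongrightarrow> \<gamma> s) (at s within I)"
    using curve_continuous[OF c] s by (simp add: continuous_on)
  have "finite F" unfolding F_def by (rule finite_curve_fibre[OF c])
  then have "\<not> s islimpt F" by (rule islimpt_finite)
  then have "\<forall>\<^sub>F t in at s within I. t \<notin> F"
    unfolding islimpt_iff_eventually eventually_at_filter by (auto elim: eventually_mono)
  moreover have "\<forall>\<^sub>F t in at s within I. t \<in> I"
    by (simp add: eventually_at_filter)
  ultimately have "\<forall>\<^sub>F t in at s within I. \<gamma> t \<in> \<gamma> ` I \<and> \<gamma> t \<noteq> \<gamma> s"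
    by eventually_elim (auto simp: F_def)
  then have "filterlim \<gamma> (at (\<gamma> s) within \<gamma> ` I) (at s within I)"
    using lim by (simp add: filterlim_at)
  moreover have "at s within I \<noteq> bot"
    using curve_parameter_islimpt[OF c s] by (simp add: trivial_limit_within)
  ultimately have "at (\<gamma> s) within \<gamma> ` I \<noteq> bot"
    unfolding filterlim_def by (auto simp: bot_unique filtermap_bot_iff)
  then show ?thesis by (simp add: trivial_limit_within)
qed

lemma countable_curve_preimage:
  assumes "oriented_simple_curve I \<gamma>" "countable Z"
  shows "countable {s \<in> I. \<gamma> s \<in> Z}"
proof -
  have "{s \<in> I. \<gamma> s \<in> Z} = (\<Union>z\<in>Z. {s \<in> I. \<gamma> s = z})" by auto
  then show ?thesis using finite_curve_fibre[OF assms(1)] assms(2) by (auto simp: countable_finite)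
qed

lemma finite_curve_preimage:
  assumes "oriented_simple_curve I \<gamma>" "finite Z"
  shows "finite {s \<in> I. \<gamma> s \<in> Z}"
proof -
  have "{s \<in> I. \<gamma> s \<in> Z} = (\<Union>z\<in>Z. {s \<in> I. \<gamma> s = z})" by auto
  then show ?thesis using finite_curve_fibre[OF assms(1)] assms(2) by auto
qed

section \<open>Derivatives of a regular weight along the curve\<close>

lemma mem_weight_support: "f z \<noteq> 0 \<Longrightarrow> z \<in> \<Gamma> \<Longrightarrow> z \<in> weight_support \<Gamma> f"
  using closure_subset[of "{z \<in> \<Gamma>. f z \<noteq> 0}"] unfolding weight_support_def by blast

lemma has_field_derivative_zero_off_support:
  assumes z: "z \<in> \<Gamma>" "z \<notin> weight_support \<Gamma> f"
  shows "(f has_field_derivative 0) (at z within \<Gamma>)"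
proof -
  have "open (- weight_support \<Gamma> f)"
    unfolding weight_support_def by (rule open_Compl) (rule closed_closure)
  then obtain d where d: "d > 0" "ball z d \<subseteq> - weight_support \<Gamma> f"
    using openE[of "- weight_support \<Gamma> f" z] z(2) by blast
  show ?thesis
  proof (rule has_field_derivative_transform_within[of "\<lambda>_. 0" 0 z \<Gamma> d f])
    fix y assume y: "y \<in> \<Gamma>" "dist y z < d"
    then have "y \<in> ball z d" by (simp add: dist_commute)
    then have "y \<notin> weight_support \<Gamma> f" using d(2) by blast
    then show "0 = f y" using mem_weight_support[of f y \<Gamma>] y(1) by metis
  qed (simp_all add: d(1) z(1))
qed

text \<open>Regularity demands differentiability only on the support without its endpoints; at
  points off the support the weight is locally 0.\<close>

lemma regular_weight_has_deriv_along:
  assumes c: "oriented_simple_curve I \<gamma>" and f: "regular_weight I \<gamma> f"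
    and z: "z \<in> \<gamma> ` I - support_endpoints I \<gamma> f"
  shows "(f has_field_derivative deriv_along (\<gamma> ` I) f z) (at z within \<gamma> ` I)"
proof -
  obtain s where s: "s \<in> I" "z = \<gamma> s" using z by blast
  have lp: "z islimpt \<gamma> ` I" unfolding s(2) by (rule curve_point_islimpt[OF c s(1)])
  have "f field_differentiable (at z within \<gamma> ` I)"
  proof (cases "z \<in> weight_support (\<gamma> ` I) f")
    case True
    then show ?thesis using f z unfolding regular_weight_def by blast
  next
    case False
    with z have "(f has_field_derivative 0) (at z within \<gamma> ` I)"
      by (intro has_field_derivative_zero_off_support) simp_all
    then show ?thesis unfolding field_differentiable_def by (rule exI)
  qed
  then obtain D where D: "(f has_field_derivative D) (at z within \<gamma> ` I)"
    unfolding field_differentiable_def by (elim exE)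
  show ?thesis unfolding deriv_along_eq[OF D lp] by (rule D)
qed

text \<open>A zero of the weight at which its derivative does not vanish is isolated among the zeros. This makes
  \<open>v\<^sub>k' w\<^sub>k = - w\<^sub>k'\<close> hold almost everywhere, although \<open>v\<^sub>k'\<close> is arbitrary where \<open>w\<^sub>k\<close> is 0.\<close>

lemma regular_weight_zero_deriv:
  assumes c: "oriented_simple_curve I \<gamma>" and f: "regular_weight I \<gamma> f"
  shows "countable {z \<in> \<gamma> ` I. f z = 0 \<and> deriv_along (\<gamma> ` I) f z \<noteq> 0}"
proof -
  define Z where "Z = {z \<in> \<gamma> ` I. f z = 0}"
  have Z: "Z \<subseteq> \<gamma> ` I" by (auto simp: Z_def)
  have zero: "deriv_along (\<gamma> ` I) f z = 0"
    if z: "z \<in> Z" "z \<notin> support_endpoints I \<gamma> f" and lim: "z islimpt Z" for z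
  proof -
    have "z \<in> \<gamma> ` I - support_endpoints I \<gamma> f" using z Z by blast
    then have "(f has_field_derivative deriv_along (\<gamma> ` I) f z) (at z within Z)"
      by (rule DERIV_subset[OF regular_weight_has_deriv_along[OF c f] Z])
    \<comment> \<open>Restricted to its own zero set the weight is constant, so the derivative
      computed along \<open>Z\<close> is 0.\<close>
    moreover have "(f has_field_derivative 0) (at z within Z)"
      using z(1) by (intro has_field_derivative_transform_within[of "\<lambda>_. 0" 0 z Z 1 f]) (simp_all add: Z_def)
    ultimately show ?thesis using lim by (rule has_field_derivative_within_unique)
  qed
  have "countable (support_endpoints I \<gamma> f)"
    using f unfolding regular_weight_def by (intro countable_finite) blast
  with countable_non_limit_points[of Z]
  have "countable ({z \<in> Z. \<not> z islimpt Z} \<union> support_endpoints I \<gamma> f)"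
    by (rule countable_Un)
  moreover have "{z \<in> \<gamma> ` I. f z = 0 \<and> deriv_along (\<gamma> ` I) f z \<noteq> 0} \<subseteq>
    {z \<in> Z. \<not> z islimpt Z} \<union> support_endpoints I \<gamma> f"
  proof
    fix z assume "z \<in> {z \<in> \<gamma> ` I. f z = 0 \<and> deriv_along (\<gamma> ` I) f z \<noteq> 0}"
    then have "z \<in> Z" "deriv_along (\<gamma> ` I) f z \<noteq> 0" by (simp_all add: Z_def)
    then show "z \<in> {z \<in> Z. \<not> z islimpt Z} \<union> support_endpoints I \<gamma> f" using zero[of z] by blast
  qed
  ultimately show ?thesis by (rule countable_subset[rotated])
qed

lemma regular_weight_continuous:
  assumes "regular_weight I \<gamma> f"
  shows "continuous_on (\<gamma> ` I) f"
  unfolding continuous_on_def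
proof
  fix z assume z: "z \<in> \<gamma> ` I"
  have "\<exists>e>0. \<exists>C. \<exists>\<alpha>>0. \<alpha> \<le> 1 \<and>
      (\<forall>s\<in>\<gamma> ` I \<inter> ball z e. \<forall>t\<in>\<gamma> ` I \<inter> ball z e. dist (f s) (f t) \<le> C * dist s t powr \<alpha>)"
    using assms z unfolding regular_weight_def locally_Hoelder_on_def by (elim conjE bspec)
  then obtain e C \<alpha> where e: "e > 0" "\<alpha> > 0"
    and C: "\<forall>s\<in>\<gamma> ` I \<inter> ball z e. \<forall>t\<in>\<gamma> ` I \<inter> ball z e. dist (f s) (f t) \<le> C * dist s t powr \<alpha>"
    by (elim exE conjE)
  have "((\<lambda>s. dist s z) \<longlongrightarrow> dist z z) (at z within \<gamma> ` I)"
    by (intro tendsto_dist tendsto_ident_at tendsto_const)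
  then have "((\<lambda>s. dist s z powr \<alpha>) \<longlongrightarrow> 0) (at z within \<gamma> ` I)"
    using e(2) by (intro tendsto_zero_powrI[OF _ tendsto_const]) simp_all
  then have lim: "((\<lambda>s. C * dist s z powr \<alpha>) \<longlongrightarrow> 0) (at z within \<gamma> ` I)"
    by (rule tendsto_mult_right_zero)
  have "\<forall>\<^sub>F s in at z within \<gamma> ` I. dist (f s) (f z) \<le> C * dist s z powr \<alpha>"
    unfolding eventually_at
  proof (intro exI[of _ e] conjI ballI impI)
    fix s assume "s \<in> \<gamma> ` I" "s \<noteq> z \<and> dist s z < e"
    then show "dist (f s) (f z) \<le> C * dist s z powr \<alpha>"
      using C[rule_format, of s z] z e(1) by (simp add: dist_commute)
  qed (rule e(1))
  then have "((\<lambda>s. dist (f s) (f z)) \<longlongrightarrow> 0) (at z within \<gamma> ` I)"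
    by (intro tendsto_sandwich[OF _ _ tendsto_const lim]) simp_all
  then show "(f \<longlongrightarrow> f z) (at z within \<gamma> ` I)" by (rule tendsto_dist_iff[THEN iffD2])
qed

section \<open>Integrals of polynomials against a weight and its derivative\<close>

lemma regular_weight_poly_integrable:
  assumes "regular_weight I \<gamma> f"
  shows "curve_integrable I \<gamma> (\<lambda>t. poly p t * f t)"
    "curve_integrable I \<gamma> (\<lambda>t. poly p t * deriv_along (\<gamma> ` I) f t)"
proof -
  have eq: "(\<lambda>t. poly p t * g t) = (\<lambda>t. \<Sum>i\<le>degree p. coeff p i * (t ^ i * g t))" for g :: "complex \<Rightarrow> complex"
    by (simp add: poly_altdef sum_distrib_right mult.assoc)
  show "curve_integrable I \<gamma> (\<lambda>t. poly p t * f t)"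
    "curve_integrable I \<gamma> (\<lambda>t. poly p t * deriv_along (\<gamma> ` I) f t)"
    unfolding eq using assms
    by (auto simp: regular_weight_def intro!: curve_integrable_sum curve_integrable_cmult)
qed

text \<open>Differentiability may fail at the break points of \<open>\<gamma>\<close> and over the
  support endpoints. Both are finitely many parameters, the latter because fibres are finite, and
  Hoelder continuity makes the product continuous across them.\<close>

lemma curve_fundamental_theorem:
  assumes c: "oriented_simple_curve I \<gamma>" and f: "regular_weight I \<gamma> f"
    and ab: "{a..b} \<subseteq> I" "a \<le> b"
  shows "((\<lambda>s. (poly p (\<gamma> s) * deriv_along (\<gamma> ` I) f (\<gamma> s) + poly (pderiv p) (\<gamma> s) * f (\<gamma> s)) *
            vector_derivative \<gamma> (at s within I))
          has_integral (poly p (\<gamma> b) * f (\<gamma> b) - poly p (\<gamma> a) * f (\<gamma> a))) {a..b}"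
proof -
  have "\<gamma> piecewise_C1_differentiable_on I" using c by (simp add: oriented_simple_curve_def)
  then obtain S where S: "finite S" and "\<gamma> C1_differentiable_on (I - S)"
    unfolding piecewise_C1_differentiable_on_def by blast
  then obtain D where D: "\<And>s. s \<in> I - S \<Longrightarrow> (\<gamma> has_vector_derivative D s) (at s)"
    unfolding C1_differentiable_on_def by blast
  define E where "E = {s \<in> I. \<gamma> s \<in> support_endpoints I \<gamma> f}"
  have "finite E"
    unfolding E_def using f by (intro finite_curve_preimage[OF c]) (simp add: regular_weight_def)
  have cont: "continuous_on I (\<lambda>s. poly p (\<gamma> s) * f (\<gamma> s))"
    using continuous_on_compose[OF curve_continuous[OF c] regular_weight_continuous[OF f]]
    by (intro continuous_on_mult continuous_on_poly curve_continuous[OF c]) (simp add: o_def)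
  show ?thesis
  proof (rule fundamental_theorem_of_calculus_interior_strong[of "S \<union> E"])
    show "finite (S \<union> E)" using S \<open>finite E\<close> by simp
    show "a \<le> b" by fact
    show "continuous_on {a..b} (\<lambda>s. poly p (\<gamma> s) * f (\<gamma> s))"
      using cont ab(1) by (rule continuous_on_subset)
    fix s assume s: "s \<in> {a<..<b} - (S \<union> E)"
    then have sI: "s \<in> I" using ab by auto
    have "s \<in> interior I"
      using s ab(1) by (intro interiorI[of "{a<..<b}"]) auto
    then have at: "at s within I = at s" by (rule at_within_interior)
    have g: "(\<gamma> has_vector_derivative D s) (at s within I)" using D s sI at by simp
    then have vd: "vector_derivative \<gamma> (at s within I) = D s"
      unfolding at by (rule vector_derivative_at)
    have "(f \<circ> \<gamma> has_vector_derivative D s * deriv_along (\<gamma> ` I) f (\<gamma> s)) (at s within I)"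
      using s sI by (intro field_vector_diff_chain_within[OF g] regular_weight_has_deriv_along[OF c f]) (auto simp: E_def)
    moreover have "(poly p \<circ> \<gamma> has_vector_derivative D s * poly (pderiv p) (\<gamma> s)) (at s within I)"
      by (rule field_vector_diff_chain_within[OF g has_field_derivative_at_within[OF poly_DERIV]])
    ultimately have "((\<lambda>s. (poly p \<circ> \<gamma>) s * (f \<circ> \<gamma>) s) has_vector_derivative
       (poly p \<circ> \<gamma>) s * (D s * deriv_along (\<gamma> ` I) f (\<gamma> s)) + (D s * poly (pderiv p) (\<gamma> s)) * (f \<circ> \<gamma>) s) (at s within I)"
      by (rule has_vector_derivative_mult[rotated])
    then show "((\<lambda>s. poly p (\<gamma> s) * f (\<gamma> s)) has_vector_derivative
       (poly p (\<gamma> s) * deriv_along (\<gamma> ` I) f (\<gamma> s) + poly (pderiv p) (\<gamma> s) * f (\<gamma> s)) *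
            vector_derivative \<gamma> (at s within I)) (at s)"
      by (simp add: at vd[unfolded at] o_def algebra_simps)
  qed
qed

text \<open>Finite ends belong to every nonempty interval of the exhaustion, so boundary terms there
  do not depend on \<open>k\<close>; only infinite ends are approached. For small \<open>k\<close>
  the interval may be empty.\<close>

lemma closed_interval_exhaustion:
  fixes I :: "real set"
  assumes I: "is_interval I" "closed I" "I \<noteq> {}"
    and a_def: "a = (\<lambda>k::nat. if bdd_below I then Inf I else - real k)"
    and b_def: "b = (\<lambda>k::nat. if bdd_above I then Sup I else real k)"
  shows "incseq (\<lambda>k. {a k..b k})" "(\<Union>k. {a k..b k}) = I" "\<forall>\<^sub>F k in sequentially. a k \<le> b k"
proof -
  have inf: "Inf I \<in> I" if "bdd_below I" using closed_contains_Inf I that by blast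
  have sup: "Sup I \<in> I" if "bdd_above I" using closed_contains_Sup I that by blast
  obtain u where u: "u \<in> I" using I by blast
  show "incseq (\<lambda>k. {a k..b k})" unfolding incseq_def a_def b_def by auto
  have lo: "\<exists>y\<in>I. y \<le> a k" for k
  proof (cases "bdd_below I")
    case True
    then show ?thesis using inf by (auto simp: a_def)
  next
    case False
    then obtain y where "y \<in> I" "y < - real k" by (meson bdd_below.I not_le)
    then show ?thesis using False by (auto simp: a_def intro!: bexI[of _ y])
  qed
  have hi: "\<exists>y\<in>I. b k \<le> y" for k
  proof (cases "bdd_above I")
    case True
    then show ?thesis using sup by (auto simp: b_def)
  next
    case False
    then obtain y where "y \<in> I" "real k < y" by (meson bdd_above.I not_le)
    then show ?thesis using False by (auto simp: b_def intro!: bexI[of _ y])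
  qed
  have "{a k..b k} \<subseteq> I" for k
  proof
    fix t assume "t \<in> {a k..b k}"
    then show "t \<in> I" using lo[of k] hi[of k] I(1) unfolding is_interval_1 by (meson atLeastAtMost_iff order_trans)
  qed
  moreover have ev: "\<forall>\<^sub>F k in sequentially. a k \<le> t \<and> t \<le> b k" if "t \<in> I" for t
  proof -
    obtain m where m: "real m \<ge> \<bar>t\<bar>" using real_arch_simple by blast
    have "a k \<le> t \<and> t \<le> b k" if "k \<ge> m" for k
    proof -
      have "real k \<ge> \<bar>t\<bar>" using m that by (meson of_nat_le_iff order_trans)
      then show ?thesis using \<open>t \<in> I\<close> by (auto simp: a_def b_def intro: cInf_lower cSup_upper)
    qed
    then show ?thesis unfolding eventually_sequentially by blast
  qed
  moreover have "t \<in> (\<Union>k. {a k..b k})" if "t \<in> I" for t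
    using ev[OF that] unfolding eventually_sequentially by auto
  ultimately show "(\<Union>k. {a k..b k}) = I" by blast
  show "\<forall>\<^sub>F k in sequentially. a k \<le> b k" using ev[OF u] by (rule eventually_mono) auto
qed

text \<open>A nonzero value at an end of the curve would put that end into the support and thus make
  it a support endpoint, where the weight vanishes.\<close>

lemma weight_zero_at_ends:
  assumes inj: "inj_on \<gamma> I" and v: "vanishes_at_endpoints I \<gamma> f" and s: "s \<in> I" "s \<in> frontier I"
  shows "f (\<gamma> s) = 0"
proof (rule ccontr)
  assume nz: "f (\<gamma> s) \<noteq> 0"
  then have "\<gamma> s \<in> weight_support (\<gamma> ` I) f"
    using s closure_subset[of "{z \<in> \<gamma> ` I. f z \<noteq> 0}"] by (auto simp: weight_support_def)
  then have "\<gamma> s \<in> support_endpoints I \<gamma> f" using inj s by (simp add: support_endpoints_def)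
  then show False using v nz by (simp add: vanishes_at_endpoints_def)
qed

lemma poly_tendsto_zero_of_powers:
  fixes g h :: "'a \<Rightarrow> complex"
  assumes "\<And>m. ((\<lambda>s. g s ^ m * h s) \<longlongrightarrow> 0) F"
  shows "((\<lambda>s. poly p (g s) * h s) \<longlongrightarrow> 0) F"
proof -
  have "((\<lambda>s. \<Sum>i\<le>degree p. coeff p i * (g s ^ i * h s)) \<longlongrightarrow> (\<Sum>i\<le>degree p. coeff p i * 0)) F"
    by (intro tendsto_sum tendsto_mult tendsto_const assms)
  then show ?thesis by (simp add: poly_altdef sum_distrib_right mult.assoc)
qed

text \<open>On a closed curve nothing forces the weight to vanish where the two ends meet; the
  boundary terms cancel because they are equal.\<close>

lemma noninjective_curve_closed:
  assumes c: "oriented_simple_curve I \<gamma>" and "\<not> inj_on \<gamma> I"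
  shows "bdd_below I" "bdd_above I" "\<gamma> (Inf I) = \<gamma> (Sup I)"
proof -
  obtain s t where st: "s \<in> I" "t \<in> I" "\<gamma> s = \<gamma> t" "s \<noteq> t" using assms(2) by (auto simp: inj_on_def)
  then have I: "I = closed_segment s t" using c by (auto simp: oriented_simple_curve_def)
  then show "bdd_below I" "bdd_above I" by (auto simp: closed_segment_eq_real_ivl)
  show "\<gamma> (Inf I) = \<gamma> (Sup I)" using st by (auto simp: I closed_segment_eq_real_ivl)
qed

text \<open>The integral of the derivative of \<open>p f\<close> is the limit of boundary terms over
  the exhausting intervals. These vanish at finite ends of an open curve by
  \<open>weight_zero_at_ends\<close>, at infinite ends by decay against every power, and on closed
  curves by cancellation.\<close>

lemma curve_integral_by_parts:
  assumes c: "oriented_simple_curve I \<gamma>" and f: "regular_weight I \<gamma> f" and v: "vanishes_at_endpoints I \<gamma> f"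
  shows "curve_integral I \<gamma> (\<lambda>t. poly p t * deriv_along (\<gamma> ` I) f t) =
    - curve_integral I \<gamma> (\<lambda>t. poly (pderiv p) t * f t)"
proof -
  let ?h = "\<lambda>t. poly p t * deriv_along (\<gamma> ` I) f t + poly (pderiv p) t * f t"
  let ?F = "\<lambda>s. poly p (\<gamma> s) * f (\<gamma> s)"
  let ?G = "\<lambda>s. ?h (\<gamma> s) * vector_derivative \<gamma> (at s within I)"
  have int: "curve_integrable I \<gamma> ?h"
    using f by (intro curve_integrable_add regular_weight_poly_integrable)
  have Iprops: "is_interval I" "closed I" "I \<noteq> {}"
    using c interior_subset[of I] by (auto simp: oriented_simple_curve_def)
  define a where "a = (\<lambda>k::nat. if bdd_below I then Inf I else - real k)"
  define b where "b = (\<lambda>k::nat. if bdd_above I then Sup I else real k)"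
  note ex = closed_interval_exhaustion[OF Iprops a_def b_def]
  have sub: "{a k..b k} \<subseteq> I" for k
    using UN_upper[of k UNIV "\<lambda>k. {a k..b k}"] ex(2) by simp
  have G: "?G absolutely_integrable_on I" using int by (simp add: curve_integrable_iff)
  have lim1: "(\<lambda>k. set_lebesgue_integral lebesgue {a k..b k} ?G) \<longlonglongrightarrow> set_lebesgue_integral lebesgue I ?G"
    using set_integral_cont_up[of "\<lambda>k. {a k..b k}" lebesgue ?G] ex G by simp
  have ftc: "set_lebesgue_integral lebesgue {a k..b k} ?G = ?F (b k) - ?F (a k)" if "a k \<le> b k" for k
  proof -
    have "?G absolutely_integrable_on {a k..b k}"
      using G by (rule set_integrable_subset) (use sub in auto)
    then have "set_lebesgue_integral lebesgue {a k..b k} ?G = integral {a k..b k} ?G"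
      by (rule set_lebesgue_integral_eq_integral(2))
    also have "\<dots> = ?F (b k) - ?F (a k)"
      by (rule integral_unique[OF curve_fundamental_theorem[OF c f sub that]])
    finally show ?thesis .
  qed
  have "(\<lambda>k. ?F (b k) - ?F (a k)) \<longlonglongrightarrow> 0"
  proof (cases "inj_on \<gamma> I")
    case True
    have "(\<lambda>k. ?F (b k)) \<longlonglongrightarrow> 0"
    proof (cases "bdd_above I")
      case bdd: True
      have "Sup I \<in> I" using closed_contains_Sup Iprops bdd by blast
      moreover have "Sup I \<notin> interior I"
      proof
        assume "Sup I \<in> interior I"
        then obtain e where "e > 0" "cball (Sup I) e \<subseteq> I" using mem_interior_cball by blast
        then have "Sup I + e \<in> I" by (auto simp: subset_eq dist_real_def)
        then show False using cSup_upper[OF _ bdd] \<open>e > 0\<close> by fastforce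
      qed
      ultimately have "f (\<gamma> (Sup I)) = 0"
        using weight_zero_at_ends[OF True v] closure_subset[of I] by (auto simp: frontier_def)
      then show ?thesis using bdd by (simp add: b_def)
    next
      case False
      then have "(?F \<longlongrightarrow> 0) at_top"
        using v by (intro poly_tendsto_zero_of_powers) (auto simp: vanishes_at_endpoints_def)
      then have "(\<lambda>k. ?F (real k)) \<longlonglongrightarrow> 0"
        using filterlim_real_sequentially by (rule filterlim_compose)
      then show ?thesis using False by (simp add: b_def)
    qed
    moreover have "(\<lambda>k. ?F (a k)) \<longlonglongrightarrow> 0"
    proof (cases "bdd_below I")
      case bdd: True
      have "Inf I \<in> I" using closed_contains_Inf Iprops bdd by blast
      moreover have "Inf I \<notin> interior I"
      proof
        assume "Inf I \<in> interior I"
        then obtain e where "e > 0" "cball (Inf I) e \<subseteq> I" using mem_interior_cball by blast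
        then have "Inf I - e \<in> I" by (auto simp: subset_eq dist_real_def)
        then show False using cInf_lower[OF _ bdd] \<open>e > 0\<close> by fastforce
      qed
      ultimately have "f (\<gamma> (Inf I)) = 0"
        using weight_zero_at_ends[OF True v] closure_subset[of I] by (auto simp: frontier_def)
      then show ?thesis using bdd by (simp add: a_def)
    next
      case False
      then have "(?F \<longlongrightarrow> 0) at_bot"
        using v by (intro poly_tendsto_zero_of_powers) (auto simp: vanishes_at_endpoints_def)
      moreover have "filterlim (\<lambda>k. - real k) at_bot sequentially"
        using filterlim_real_sequentially by (simp add: filterlim_uminus_at_top)
      ultimately have "(\<lambda>k. ?F (- real k)) \<longlonglongrightarrow> 0" by (rule filterlim_compose)
      then show ?thesis using False by (simp add: a_def)
    qed
    ultimately have "(\<lambda>k. ?F (b k) - ?F (a k)) \<longlonglongrightarrow> 0 - 0" by (rule tendsto_diff)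
    then show ?thesis by simp
  next
    case False
    then show ?thesis using noninjective_curve_closed[OF c False] by (simp add: a_def b_def)
  qed
  moreover have "\<forall>\<^sub>F k in sequentially. ?F (b k) - ?F (a k) = set_lebesgue_integral lebesgue {a k..b k} ?G"
    using ex(3) by (rule eventually_mono) (simp add: ftc)
  ultimately have "(\<lambda>k. set_lebesgue_integral lebesgue {a k..b k} ?G) \<longlonglongrightarrow> 0"
    by (rule Lim_transform_eventually)
  then have "curve_integral I \<gamma> ?h = 0"
    using LIMSEQ_unique[OF lim1] by (simp add: curve_integral_def)
  then show ?thesis
    using curve_integral_add[OF regular_weight_poly_integrable(2)[OF f] regular_weight_poly_integrable(1)[OF f]]
    by (simp add: eq_neg_iff_add_eq_0)
qed

text \<open>Here \<open>u\<close> plays the role of \<open>v'_k\<close>, prescribed only where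
  \<open>f\<close> is nonzero. At common zeros of \<open>f\<close> and its derivative both
  integrands are 0 whatever \<open>u\<close> is, and the other zeros have only countably many
  parameters. The minus sign in \<open>u\<close> cancels the one from integration by parts.\<close>

lemma curve_integral_log_derivative:
  assumes c: "oriented_simple_curve I \<gamma>" and f: "regular_weight I \<gamma> f" and v: "vanishes_at_endpoints I \<gamma> f"
    and u: "\<And>t. t \<in> \<gamma> ` I \<Longrightarrow> f t \<noteq> 0 \<Longrightarrow> u t = - deriv_along (\<gamma> ` I) f t / f t"
  shows "curve_integrable I \<gamma> (\<lambda>t. poly p t * (u t * f t))"
    "curve_integral I \<gamma> (\<lambda>t. poly p t * (u t * f t)) = curve_integral I \<gamma> (\<lambda>t. poly (pderiv p) t * f t)"
proof -
  let ?d = "deriv_along (\<gamma> ` I) f"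
  let ?g = "\<lambda>t. (- 1) * (poly p t * ?d t)"
  define N where "N = {s \<in> I. \<gamma> s \<in> {z \<in> \<gamma> ` I. f z = 0 \<and> ?d z \<noteq> 0}}"
  have "countable N"
    unfolding N_def by (rule countable_curve_preimage[OF c regular_weight_zero_deriv[OF c f]])
  then have N: "negligible N" 
    by (simp add: negligible_iff_null_sets countable_imp_null_set_lborel null_sets_completionI)
  have int: "curve_integrable I \<gamma> ?g"
    using regular_weight_poly_integrable(2)[OF f] by (rule curve_integrable_cmult)
  have eq: "poly p (\<gamma> s) * (u (\<gamma> s) * f (\<gamma> s)) = ?g (\<gamma> s)" if "s \<in> I - N" for s
    using that u[of "\<gamma> s"] by (cases "f (\<gamma> s) = 0") (auto simp: N_def)
  show "curve_integrable I \<gamma> (\<lambda>t. poly p t * (u t * f t))"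
    by (rule curve_integral_spike(1)[OF N eq int])
  have "curve_integral I \<gamma> (\<lambda>t. poly p t * (u t * f t)) = curve_integral I \<gamma> ?g"
    by (rule curve_integral_spike(2)[OF N eq int])
  also have "\<dots> = curve_integral I \<gamma> (\<lambda>t. poly (pderiv p) t * f t)"
    unfolding curve_integral_cmult curve_integral_by_parts[OF c f v] by simp
  finally show "curve_integral I \<gamma> (\<lambda>t. poly p t * (u t * f t)) = curve_integral I \<gamma> (\<lambda>t. poly (pderiv p) t * f t)" .
qed

section \<open>Moment matrices\<close>

lemma obtain_square_preimage:
  fixes M :: "'a :: field mat"
  assumes M: "M \<in> carrier_mat N N" and d: "Determinant.det M \<noteq> 0" and b: "b \<in> carrier_vec N"
  obtains v where "v \<in> carrier_vec N" "M *\<^sub>v v = b"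
proof -
  obtain B where B: "B \<in> carrier_mat N N" "M * B = 1\<^sub>m N"
    using det_non_zero_imp_unit[OF M d, of "()"] by (auto simp: Units_def ring_mat_def)
  show ?thesis
  proof
    show "B *\<^sub>v b \<in> carrier_vec N" using B b by simp
    have "M *\<^sub>v (B *\<^sub>v b) = (M * B) *\<^sub>v b" 
      by (rule assoc_mult_mat_vec[OF M B(1) b, symmetric])
    then show "M *\<^sub>v (B *\<^sub>v b) = b" using B b by simp
  qed
qed

lemma zero_of_square_kernel:
  fixes M :: "'a :: field mat"
  assumes M: "M \<in> carrier_mat N N" and d: "Determinant.det M \<noteq> 0"
    and v: "v \<in> carrier_vec N" "M *\<^sub>v v = 0\<^sub>v N"
  shows "v = 0\<^sub>v N"
  using det_0_iff_vec_prod_zero_field[OF M] d v by blast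

text \<open>The labels \<open>(j, s)\<close> of the columns of the moment matrix, in order.\<close>

definition index_pairs :: "nat \<Rightarrow> (nat \<Rightarrow> nat) \<Rightarrow> (nat \<times> nat) list" where
  "index_pairs r n = concat (map (\<lambda>j. map (Pair j) [0..<n j]) [1..<Suc r])"

lemma length_index_pairs: "length (index_pairs r n) = mi_size r n"
proof -
  have "length (index_pairs r n) = sum_list (map n [1..<Suc r])"
    by (simp add: index_pairs_def length_concat o_def)
  then show ?thesis by (simp add: mi_size_def sum_list_distinct_conv_sum_set atLeastLessThanSuc_atLeastAtMost del: upt_Suc)
qed

lemma bij_index_pairs: "bij_betw (nth (index_pairs r n)) {..<mi_size r n} (SIGMA j:{1..r}. {..<n j})"
proof -
  have dist: "distinct (concat (map (\<lambda>j. map (Pair j) [0..<n j]) js))" if "distinct js" for js :: "nat list"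
    using that by (induction js) (auto simp: distinct_map inj_on_def)
  have "distinct (index_pairs r n)" unfolding index_pairs_def by (rule dist) (rule distinct_upt)
  moreover have "set (index_pairs r n) = (SIGMA j:{1..r}. {..<n j})"
    unfolding index_pairs_def by (auto simp del: upt_Suc simp: image_iff less_Suc_eq_le intro!: bexI)
  ultimately show ?thesis
    by (metis bij_betw_nth length_index_pairs)
qed

lemma moment_matrix_index:
  assumes "i < mi_size r n" "c < mi_size r n" "index_pairs r n ! c = (j, s)"
  shows "moment_matrix I \<gamma> r w n $$ (i, c) = moment I \<gamma> (w j) (s + i)"
proof -
  have "concat (map (\<lambda>j. map (\<lambda>s. Matrix.vec (mi_size r n) (\<lambda>i. moment I \<gamma> (w j) (s + i))) [0..<n j]) [1..<Suc r])
    = map (\<lambda>(j, s). Matrix.vec (mi_size r n) (\<lambda>i. moment I \<gamma> (w j) (s + i))) (index_pairs r n)"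
    by (simp add: index_pairs_def map_concat o_def del: upt_Suc)
  then show ?thesis
    using assms by (simp add: moment_matrix_def mat_of_cols_index length_index_pairs)
qed

lemma moment_matrix_carrier: "moment_matrix I \<gamma> r w n \<in> carrier_mat (mi_size r n) (mi_size r n)"
proof -
  have "length (concat (map (\<lambda>j. map (\<lambda>s. Matrix.vec (mi_size r n) (\<lambda>i. moment I \<gamma> (w j) (s + i))) [0..<n j]) [1..<Suc r]))
    = length (index_pairs r n)"
    by (simp add: index_pairs_def length_concat o_def del: upt_Suc)
  then show ?thesis by (simp add: moment_matrix_def length_index_pairs mat_of_cols_def)
qed

section \<open>Degree bounds and multi-index arithmetic\<close>

lemma poly_eq_sum_of_bounded:
  assumes "\<And>i. i \<ge> N \<Longrightarrow> coeff p i = (0 :: 'a :: comm_ring_1)"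
  shows "p = (\<Sum>i<N. monom (coeff p i) i)"
  by (rule poly_eqI) (use assms in \<open>auto simp: coeff_sum not_less\<close>)

text \<open>Degree bounds are carried as vanishing coefficients below: this form treats the zero
  polynomial uniformly and is stable under linear combinations.\<close>

lemma bounded_poly_iff: "(p = 0 \<or> degree p < m) \<longleftrightarrow> (\<forall>i\<ge>m. coeff p i = 0)"
proof
  assume "\<forall>i\<ge>m. coeff p i = 0"
  then have "m \<le> degree p \<Longrightarrow> lead_coeff p = 0" by blast
  then show "p = 0 \<or> degree p < m" by (cases "m \<le> degree p") auto
qed (auto intro: coeff_eq_0)

lemma mi_size_up [simp]: "j \<in> {1..r} \<Longrightarrow> mi_size r (up m j) = Suc (mi_size r m)"
  using sum.remove[of "{1..r}" j m] sum.remove[of "{1..r}" j "m(j := m j + 1)"]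
  by (auto simp: mi_size_def up_def)

lemma up_down: "j \<ge> 1 \<Longrightarrow> m j \<ge> 1 \<Longrightarrow> up (down m j) j = m"
  by (auto simp: up_def down_def)

lemma mi_size_down: "j \<in> {1..r} \<Longrightarrow> m j \<ge> 1 \<Longrightarrow> mi_size r m = Suc (mi_size r (down m j))"
  using mi_size_up[of j r "down m j"] up_down[of j m] by simp

locale normal_weights =
  fixes I :: "real set" and \<gamma> :: "real \<Rightarrow> complex" and r :: nat and w :: "nat \<Rightarrow> complex \<Rightarrow> complex"
  assumes integrable: "k \<in> {1..r} \<Longrightarrow> curve_integrable I \<gamma> (\<lambda>t. poly p t * w k t)"
    and normal: "normal_index I \<gamma> r w m"
begin

definition wint :: "nat \<Rightarrow> complex poly \<Rightarrow> complex" where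
  "wint k p = curve_integral I \<gamma> (\<lambda>t. poly p t * w k t)"

text \<open>\<open>pairing q (A n)\<close> is \<open>\<integral> q(t) Q\<^sub>n(t) dt\<close>.\<close>

definition pairing :: "complex poly \<Rightarrow> (nat \<Rightarrow> complex poly) \<Rightarrow> complex" where
  "pairing q A = (\<Sum>k=1..r. wint k (q * A k))"

abbreviation P where "P \<equiv> type_II I \<gamma> r w"
abbreviation A where "A \<equiv> type_I I \<gamma> r w"
abbreviation a where "a \<equiv> rec_a I \<gamma> r w"
abbreviation b where "b \<equiv> rec_b I \<gamma> r w"
abbreviation size where "size \<equiv> mi_size r"

text \<open>The first moment of \<open>P m\<close> against the weight \<open>w j\<close> that
  orthogonality does not force to vanish; the coefficients \<open>a\<close> are quotients of two
  such numbers.\<close>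

definition h :: "(nat \<Rightarrow> nat) \<Rightarrow> nat \<Rightarrow> complex" where
  "h m j = wint j (P m * monom 1 (m j))"

lemma wint_0 [simp]: "wint k 0 = 0" by (simp add: wint_def)

lemma wint_add: "k \<in> {1..r} \<Longrightarrow> wint k (p + q) = wint k p + wint k q"
  unfolding wint_def using integrable by (simp add: ring_distribs curve_integral_add)

lemma wint_smult: "wint k (Polynomial.smult c p) = c * wint k p"
  unfolding wint_def using curve_integral_cmult[of I \<gamma> c] by (simp add: mult.assoc)

lemma wint_minus: "wint k (- p) = - wint k p"
  using wint_smult[of k "- 1" p] by simp

lemma wint_diff: "k \<in> {1..r} \<Longrightarrow> wint k (p - q) = wint k p - wint k q"
  using wint_add[of k p "- q"] by (simp add: wint_minus)

lemma wint_sum: "k \<in> {1..r} \<Longrightarrow> wint k (\<Sum>i\<in>S. f i) = (\<Sum>i\<in>S. wint k (f i))"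
  by (induction S rule: infinite_finite_induct) (auto simp: wint_add)

lemma moment_eq_wint: "moment I \<gamma> (w k) m = wint k (monom 1 m)"
  by (simp add: moment_def wint_def poly_monom)

lemma wint_expand:
  assumes k: "k \<in> {1..r}" and "\<And>i. i \<ge> N \<Longrightarrow> coeff q i = 0"
  shows "wint k (p * q) = (\<Sum>i<N. coeff q i * wint k (p * monom 1 i))"
proof -
  have "p * q = (\<Sum>i<N. Polynomial.smult (coeff q i) (p * monom 1 i))"
    by (subst poly_eq_sum_of_bounded[OF assms(2)])
      (auto simp: sum_distrib_left smult_monom intro!: sum.cong simp flip: mult_smult_right)
  then show ?thesis by (simp add: wint_sum[OF k] wint_smult)
qed

lemma pairing_add_left: "pairing (p + q) B = pairing p B + pairing q B"
  by (simp add: pairing_def ring_distribs wint_add sum.distrib)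

lemma pairing_diff_left: "pairing (p - q) B = pairing p B - pairing q B"
  by (simp add: pairing_def ring_distribs wint_diff sum_subtractf)

lemma pairing_smult_left: "pairing (Polynomial.smult c p) B = c * pairing p B"
  by (simp add: pairing_def wint_smult sum_distrib_left)

lemma pairing_sum_left: "pairing (\<Sum>i\<in>S. f i) B = (\<Sum>i\<in>S. pairing (f i) B)"
  by (induction S rule: infinite_finite_induct) (auto simp: pairing_add_left, auto simp: pairing_def)

lemma pairing_expand:
  assumes "\<And>i. i \<ge> N \<Longrightarrow> coeff q i = 0"
  shows "pairing q B = (\<Sum>i<N. coeff q i * pairing (monom 1 i) B)"
proof -
  have "pairing q B = pairing (\<Sum>i<N. Polynomial.smult (coeff q i) (monom 1 i)) B"
    by (subst poly_eq_sum_of_bounded[OF assms]) (auto simp: smult_monom)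
  then show ?thesis by (simp add: pairing_sum_left pairing_smult_left)
qed

lemma index_pairs_mem:
  assumes "c < size n" "index_pairs r n ! c = (j, s)"
  shows "j \<in> {1..r}" "s < n j"
proof -
  have "index_pairs r n ! c \<in> (SIGMA j:{1..r}. {..<n j})"
    using bij_betwE[OF bij_index_pairs[of r n]] assms(1) by blast
  then show "j \<in> {1..r}" "s < n j" by (simp_all add: assms(2))
qed

lemma index_pairs_surj:
  assumes "j \<in> {1..r}" "s < n j"
  obtains c where "c < size n" "index_pairs r n ! c = (j, s)"
proof -
  have "(j, s) \<in> nth (index_pairs r n) ` {..<size n}"
    using assms bij_betw_imp_surj_on[OF bij_index_pairs[of r n]] by auto
  then show ?thesis using that by auto
qed

lemma transpose_moment_matrix_mult_vec:
  assumes c: "c < size n" and js: "index_pairs r n ! c = (j, s)" and v: "dim_vec v = size n"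
  shows "((moment_matrix I \<gamma> r w n)\<^sup>T *\<^sub>v v) $ c = (\<Sum>i<size n. wint j (monom 1 (s + i)) * v $ i)"
  using c moment_matrix_carrier[of I \<gamma> r w n] js v
  by (auto simp: scalar_prod_def moment_matrix_index moment_eq_wint lessThan_atLeast0 intro!: sum.cong)

text \<open>The type II conditions form the transpose of the type I system: orthogonality says that
  the coefficient vector of \<open>p\<close> lies in the kernel of the transposed moment
  matrix.\<close>

lemma orthogonal_imp_zero:
  assumes deg: "\<And>i. i \<ge> size n \<Longrightarrow> coeff p i = 0"
    and orth: "\<And>j s. j \<in> {1..r} \<Longrightarrow> s < n j \<Longrightarrow> wint j (p * monom 1 s) = 0"
  shows "p = 0"
proof -
  let ?M = "moment_matrix I \<gamma> r w n" and ?N = "size n"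
  define v where "v = Matrix.vec ?N (coeff p)"
  have dim: "dim_vec v = ?N" by (simp add: v_def)
  have "?M\<^sup>T *\<^sub>v v = 0\<^sub>v ?N"
  proof (rule eq_vecI)
    fix c assume "c < dim_vec (0\<^sub>v ?N :: complex Matrix.vec)"
    then have c: "c < ?N" by simp
    obtain j s where js: "index_pairs r n ! c = (j, s)" by (cases "index_pairs r n ! c") auto
    note j = index_pairs_mem[OF c js]
    have "(?M\<^sup>T *\<^sub>v v) $ c = (\<Sum>i<?N. wint j (monom 1 (s + i)) * coeff p i)"
      unfolding transpose_moment_matrix_mult_vec[OF c js dim] by (simp add: v_def)
    also have "\<dots> = wint j (p * monom 1 s)"
      using wint_expand[OF j(1) deg, where p = "monom 1 s"] by (simp add: mult_monom ac_simps)
    finally show "(?M\<^sup>T *\<^sub>v v) $ c = 0\<^sub>v ?N $ c" using orth[OF j] c by simp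
  qed (use moment_matrix_carrier[of I \<gamma> r w n] in auto)
  moreover have "Determinant.det ?M\<^sup>T \<noteq> 0"
    using normal[of n] by (simp add: normal_index_def det_transpose[OF moment_matrix_carrier])
  moreover have "?M\<^sup>T \<in> carrier_mat ?N ?N"
    using moment_matrix_carrier by (rule transpose_carrier_mat[THEN iffD2])
  moreover have "v \<in> carrier_vec ?N" by (simp add: v_def)
  ultimately have v0: "v = 0\<^sub>v ?N" by (metis zero_of_square_kernel)
  show ?thesis
  proof (rule poly_eqI)
    fix i show "coeff p i = coeff 0 i"
    proof (cases "i < ?N")
      case True
      then have "v $ i = 0" using v0 by simp
      then show ?thesis using True by (simp add: v_def)
    qed (simp add: deg)
  qed
qed

text \<open>Regroups the sum over column numbers as a sum over labels; \<open>inv_into\<close>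
  returns the column number of a label.\<close>

lemma moment_matrix_mult_vec:
  assumes "i < size n" "dim_vec v = size n"
  shows "(moment_matrix I \<gamma> r w n *\<^sub>v v) $ i =
    (\<Sum>(j, s)\<in>(SIGMA j:{1..r}. {..<n j}).
       v $ (inv_into {..<size n} (nth (index_pairs r n)) (j, s)) * wint j (monom 1 (s + i)))"
proof -
  let ?f = "nth (index_pairs r n)"
  let ?g = "inv_into {..<size n} ?f"
  have "(moment_matrix I \<gamma> r w n *\<^sub>v v) $ i =
    (\<Sum>c<size n. moment_matrix I \<gamma> r w n $$ (i, c) * v $ c)"
    using assms moment_matrix_carrier[of I \<gamma> r w n]
    by (auto simp: scalar_prod_def lessThan_atLeast0 intro!: sum.cong)
  also have "\<dots> = (\<Sum>c<size n. (\<lambda>(j, s). v $ (?g (j, s)) * wint j (monom 1 (s + i))) (?f c))"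
  proof (rule sum.cong)
    fix c assume c: "c \<in> {..<size n}"
    obtain j s where js: "?f c = (j, s)" by (cases "?f c") auto
    have "?g (j, s) = c"
      using inv_into_f_f[OF bij_betw_imp_inj_on[OF bij_index_pairs] c] js by simp
    then show "moment_matrix I \<gamma> r w n $$ (i, c) * v $ c =
      (\<lambda>(j, s). v $ (?g (j, s)) * wint j (monom 1 (s + i))) (?f c)"
      using js assms c by (simp add: moment_matrix_index moment_eq_wint)
  qed simp
  also have "\<dots> = (\<Sum>(j, s)\<in>(SIGMA j:{1..r}. {..<n j}). v $ (?g (j, s)) * wint j (monom 1 (s + i)))"
    by (rule sum.reindex_bij_betw[OF bij_index_pairs])
  finally show ?thesis .
qed

lemma pairing_monom_expand:
  assumes "\<And>j i. j \<in> {1..r} \<Longrightarrow> i \<ge> n j \<Longrightarrow> coeff (B j) i = 0"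
  shows "pairing (monom 1 k) B = (\<Sum>(j, s)\<in>(SIGMA j:{1..r}. {..<n j}). coeff (B j) s * wint j (monom 1 (s + k)))"
proof -
  have "wint j (monom 1 k * B j) = (\<Sum>s<n j. coeff (B j) s * wint j (monom 1 (s + k)))" if j: "j \<in> {1..r}" for j
    using wint_expand[OF j assms[OF j], where p = "monom 1 k"] by (simp add: mult_monom add.commute)
  then show ?thesis by (simp add: pairing_def sum.Sigma)
qed

text \<open>Dual to \<open>orthogonal_imp_zero\<close>: the stacked coefficients of all components
  lie in the kernel of the moment matrix itself.\<close>

lemma pairing_zero_imp_zero:
  assumes deg: "\<And>j i. j \<in> {1..r} \<Longrightarrow> i \<ge> n j \<Longrightarrow> coeff (B j) i = 0"
    and orth: "\<And>k. k < size n \<Longrightarrow> pairing (monom 1 k) B = 0"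
    and j: "j \<in> {1..r}"
  shows "B j = 0"
proof -
  let ?M = "moment_matrix I \<gamma> r w n" and ?N = "size n"
  let ?f = "nth (index_pairs r n)"
  let ?g = "inv_into {..<?N} ?f"
  \<comment> \<open>The coefficients of all components in the order of the columns.\<close>
  define v where "v = Matrix.vec ?N (\<lambda>c. (\<lambda>(j, s). coeff (B j) s) (?f c))"
  have vg: "?g (j, s) < ?N" "v $ (?g (j, s)) = coeff (B j) s" if "j \<in> {1..r}" "s < n j" for j s
  proof -
    have js: "(j, s) \<in> ?f ` {..<?N}"
      using that bij_betw_imp_surj_on[OF bij_index_pairs[of r n]] by auto
    show 1: "?g (j, s) < ?N" using inv_into_into[OF js] by simp
    show "v $ (?g (j, s)) = coeff (B j) s" using 1 f_inv_into_f[OF js] by (simp add: v_def)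
  qed
  have det: "Determinant.det ?M \<noteq> 0" using normal[of n] by (simp add: normal_index_def)
  have "?M *\<^sub>v v = 0\<^sub>v ?N"
  proof (rule eq_vecI)
    fix i assume "i < dim_vec (0\<^sub>v ?N :: complex Matrix.vec)"
    then have i: "i < ?N" by simp
    have "(?M *\<^sub>v v) $ i =
      (\<Sum>(j, s)\<in>(SIGMA j:{1..r}. {..<n j}). v $ (?g (j, s)) * wint j (monom 1 (s + i)))"
      by (rule moment_matrix_mult_vec[OF i]) (simp add: v_def)
    also have "\<dots> = (\<Sum>(j, s)\<in>(SIGMA j:{1..r}. {..<n j}). coeff (B j) s * wint j (monom 1 (s + i)))"
      by (rule sum.cong) (auto simp: vg(2))
    also have "\<dots> = pairing (monom 1 i) B"
      by (rule pairing_monom_expand[OF deg, symmetric])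
    finally have "(?M *\<^sub>v v) $ i = pairing (monom 1 i) B" .
    then show "(?M *\<^sub>v v) $ i = 0\<^sub>v ?N $ i" using orth i by simp
  qed (use moment_matrix_carrier[of I \<gamma> r w n] in auto)
  moreover have "v \<in> carrier_vec ?N" by (simp add: v_def)
  ultimately have v0: "v = 0\<^sub>v ?N"
    by (rule zero_of_square_kernel[OF moment_matrix_carrier det, rotated])
  show ?thesis
  proof (rule poly_eqI)
    fix s show "coeff (B j) s = coeff 0 s"
    proof (cases "s < n j")
      case True
      then show ?thesis using vg[OF j True] v0 by simp
    qed (use deg[OF j, of s] in simp)
  qed
qed

section \<open>Type II polynomials: existence, uniqueness, orthogonality\<close>

lemma wint_mult_monom: "wint j (p * monom 1 k) = curve_integral I \<gamma> (\<lambda>t. poly p t * t ^ k * w j t)"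
  by (simp add: wint_def poly_monom)

lemma is_type_II_iff:
  "is_type_II I \<gamma> r w n p \<longleftrightarrow> coeff p (size n) = 1 \<and> (\<forall>i>size n. coeff p i = 0) \<and>
    (\<forall>j\<in>{1..r}. \<forall>s<n j. wint j (p * monom 1 s) = 0)"
proof -
  have "degree p = size n \<and> lead_coeff p = 1 \<longleftrightarrow> coeff p (size n) = 1 \<and> (\<forall>i>size n. coeff p i = 0)"
    using degree_le[of "size n" p] le_degree[of p "size n"] coeff_eq_0[of p]
    by (metis le_antisym zero_neq_one)
  then show ?thesis unfolding is_type_II_def wint_mult_monom by blast
qed

lemma type_II_exists: "\<exists>p. is_type_II I \<gamma> r w n p"
proof -
  let ?M = "moment_matrix I \<gamma> r w n" and ?N = "size n"
  \<comment> \<open>The prescribed leading term x^|n| contributes known moments, which are moved to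
    the right-hand side.\<close>
  let ?b = "Matrix.vec ?N (\<lambda>c. case index_pairs r n ! c of (j, s) \<Rightarrow> - wint j (monom 1 (?N + s)))"
  have M: "?M\<^sup>T \<in> carrier_mat ?N ?N"
    using moment_matrix_carrier by (rule transpose_carrier_mat[THEN iffD2])
  have "Determinant.det ?M\<^sup>T \<noteq> 0"
    using normal[of n] by (simp add: normal_index_def det_transpose[OF moment_matrix_carrier])
  then obtain v where v: "v \<in> carrier_vec ?N" "?M\<^sup>T *\<^sub>v v = ?b"
    by (rule obtain_square_preimage[OF M, of ?b]) simp_all
  have dim: "dim_vec v = ?N" using v(1) by simp
  define p where "p = monom 1 ?N + (\<Sum>i<?N. monom (v $ i) i)"
  have co: "coeff p i = (if i < ?N then v $ i else if i = ?N then 1 else 0)" for i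
    by (auto simp: p_def coeff_sum)
  have "wint j (p * monom 1 s) = 0" if j: "j \<in> {1..r}" and s: "s < n j" for j s
  proof -
    obtain c where c: "c < ?N" "index_pairs r n ! c = (j, s)" by (rule index_pairs_surj[where n = n, OF j s])
    have "(?M\<^sup>T *\<^sub>v v) $ c = - wint j (monom 1 (?N + s))"
      unfolding v(2) using c by simp
    then have sum: "(\<Sum>i<?N. wint j (monom 1 (s + i)) * v $ i) = - wint j (monom 1 (?N + s))"
      unfolding transpose_moment_matrix_mult_vec[OF c dim] .
    have "wint j (monom 1 s * p) = (\<Sum>i<Suc ?N. coeff p i * wint j (monom 1 s * monom 1 i))"
      by (rule wint_expand[OF j]) (simp add: co)
    also have "\<dots> = (\<Sum>i<?N. wint j (monom 1 (s + i)) * v $ i) + wint j (monom 1 (?N + s))"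
      by (simp add: co mult_monom ac_simps)
    finally show ?thesis unfolding sum by (simp add: mult.commute[of p])
  qed
  then have "is_type_II I \<gamma> r w n p" unfolding is_type_II_iff by (intro conjI ballI allI impI) (simp_all add: co)
  then show ?thesis by (rule exI[of _ p])
qed

lemma type_II_unique:
  assumes "is_type_II I \<gamma> r w n p" "is_type_II I \<gamma> r w n q"
  shows "p = q"
proof -
  have "p - q = 0"
  proof (rule orthogonal_imp_zero)
    show "coeff (p - q) i = 0" if "size n \<le> i" for i
      using assms that by (cases "i = size n") (auto simp: is_type_II_iff)
    show "wint j ((p - q) * monom 1 s) = 0" if "j \<in> {1..r}" "s < n j" for j s
      using assms that by (simp add: is_type_II_iff left_diff_distrib wint_diff)
  qed
  then show ?thesis by simp
qed

lemma P_spec: "is_type_II I \<gamma> r w n (P n)"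
  unfolding type_II_def by (rule theI'[OF ex_ex1I[OF type_II_exists type_II_unique]])

lemma P_coeff_top [simp]: "coeff (P n) (size n) = 1"
  and P_coeff_above: "size n < i \<Longrightarrow> coeff (P n) i = 0"
  and P_orth: "j \<in> {1..r} \<Longrightarrow> s < n j \<Longrightarrow> wint j (P n * monom 1 s) = 0"
  using P_spec[of n] unfolding is_type_II_iff by blast+

text \<open>Orthogonality annihilates all lower powers, so the integral sees only the coefficient of
  x^(n_j).\<close>

lemma wint_P_top:
  assumes j: "j \<in> {1..r}" and q: "\<And>i. i > n j \<Longrightarrow> coeff q i = 0"
  shows "wint j (P n * q) = coeff q (n j) * h n j"
proof -
  have "wint j (P n * q) = (\<Sum>i<Suc (n j). coeff q i * wint j (P n * monom 1 i))"
    by (rule wint_expand[OF j]) (simp add: q)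
  then show ?thesis by (simp add: P_orth[OF j] h_def)
qed

lemma wint_P_low:
  assumes j: "j \<in> {1..r}" and q: "\<And>i. i \<ge> n j \<Longrightarrow> coeff q i = 0"
  shows "wint j (P n * q) = 0"
  using wint_P_top[OF j, of n q] q by simp

section \<open>Type I vectors: existence, uniqueness, normalization\<close>

lemma pairing_monom: 
  "pairing (monom 1 k) B = (\<Sum>j=1..r. curve_integral I \<gamma> (\<lambda>t. t ^ k * poly (B j) t * w j t))"
  by (simp add: pairing_def wint_def poly_monom)

lemma pairing_diff_right: "pairing q (\<lambda>k. B k - C k) = pairing q B - pairing q C"
  by (simp add: pairing_def ring_distribs wint_diff sum_subtractf)

lemma pairing_smult_right: "pairing q (\<lambda>k. Polynomial.smult c (B k)) = c * pairing q B"
  by (simp add: pairing_def wint_smult sum_distrib_left)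

lemma pairing_sum_right: "pairing q (\<lambda>k. \<Sum>i\<in>S. f i k) = (\<Sum>i\<in>S. pairing q (f i))"
proof -
  have "pairing q (\<lambda>k. \<Sum>i\<in>S. f i k) = (\<Sum>k=1..r. \<Sum>i\<in>S. wint k (q * f i k))"
    unfolding pairing_def by (rule sum.cong) (simp_all add: sum_distrib_left wint_sum)
  then show ?thesis unfolding pairing_def by (simp only: sum.swap[of _ S])
qed

lemma pairing_pCons_right: "pairing q (\<lambda>k. pCons 0 (B k)) = pairing (pCons 0 q) B"
  by (simp add: pairing_def mult_pCons_left mult_pCons_right)

text \<open>Vanishing and normalization merge into one Kronecker delta for all k < |n|. Comparing
  \<open>Suc k\<close> with |n| avoids truncated subtraction, and for |n| = 0 there is no condition
  on either side.\<close>

lemma is_type_I_iff: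
  "is_type_I I \<gamma> r w n B \<longleftrightarrow>
    (\<forall>j\<in>{1..r}. \<forall>i\<ge>n j. coeff (B j) i = 0) \<and> (\<forall>j. j \<notin> {1..r} \<longrightarrow> B j = 0) \<and>
    (\<forall>k<size n. pairing (monom 1 k) B = (if Suc k = size n then 1 else 0))"
proof -
  have "(\<forall>k. k + 2 \<le> size n \<longrightarrow> f k = 0) \<and> (size n \<ge> 1 \<longrightarrow> f (size n - 1) = 1) \<longleftrightarrow>
    (\<forall>k<size n. f k = (if Suc k = size n then 1 else 0))" (is "?L \<longleftrightarrow> ?R") for f :: "nat \<Rightarrow> complex"
  proof
    assume L: ?L
    show ?R
    proof (intro allI impI)
      fix k assume k: "k < size n"
      show "f k = (if Suc k = size n then 1 else 0)"
      proof (cases "Suc k = size n")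
        case True
        then have "size n \<ge> 1" "k = size n - 1" by linarith+
        with L True show ?thesis by (metis (full_types))
      next
        case False
        with k have "k + 2 \<le> size n" by linarith
        with L have "f k = 0" by blast
        with False show ?thesis by (simp only: if_False)
      qed
    qed
  next
    assume R: ?R
    have "f k = 0" if "k + 2 \<le> size n" for k
    proof -
      have "k < size n" "Suc k \<noteq> size n" using that by linarith+
      then show ?thesis using R by (metis (full_types))
    qed
    moreover have "f (size n - 1) = 1" if "size n \<ge> 1"
    proof -
      have "size n - 1 < size n" "Suc (size n - 1) = size n" using that by linarith+
      then show ?thesis using R by (metis (full_types))
    qed
    ultimately show ?L by blast
  qed
  note eq = this[of "\<lambda>k. pairing (monom 1 k) B"]
  show ?thesis
    unfolding is_type_I_def bounded_poly_iff pairing_monom[symmetric] eq by (rule refl)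
qed

lemma type_I_exists: "\<exists>B. is_type_I I \<gamma> r w n B"
proof -
  let ?M = "moment_matrix I \<gamma> r w n" and ?N = "size n"
  let ?g = "inv_into {..<?N} (nth (index_pairs r n))"
  let ?b = "Matrix.vec ?N (\<lambda>k. if Suc k = ?N then 1 else 0 :: complex)"
  have "Determinant.det ?M \<noteq> 0"
    using normal[of n] by (simp add: normal_index_def)
  then obtain v where v: "v \<in> carrier_vec ?N" "?M *\<^sub>v v = ?b"
    by (rule obtain_square_preimage[OF moment_matrix_carrier, of _ _ _ _ _ ?b]) simp_all
  have dim: "dim_vec v = ?N" using v(1) by simp
  define B where "B = (\<lambda>j. if j \<in> {1..r} then \<Sum>s<n j. monom (v $ ?g (j, s)) s else 0)"
  have co: "coeff (B j) i = (if i < n j then v $ ?g (j, i) else 0)" if "j \<in> {1..r}" for i j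
    using that by (auto simp: B_def coeff_sum)
  have deg: "coeff (B j) i = 0" if "j \<in> {1..r}" "n j \<le> i" for i j using that by (simp add: co)
  have "pairing (monom 1 k) B = (if Suc k = ?N then 1 else 0)" if k: "k < ?N" for k
  proof -
    have "pairing (monom 1 k) B =
      (\<Sum>(j, s)\<in>(SIGMA j:{1..r}. {..<n j}). coeff (B j) s * wint j (monom 1 (s + k)))"
      by (rule pairing_monom_expand[OF deg])
    also have "\<dots> = (\<Sum>(j, s)\<in>(SIGMA j:{1..r}. {..<n j}). v $ ?g (j, s) * wint j (monom 1 (s + k)))"
      by (rule sum.cong) (auto simp: co)
    also have "\<dots> = (?M *\<^sub>v v) $ k" by (rule moment_matrix_mult_vec[OF k dim, symmetric])
    finally show ?thesis using k by (simp add: v(2))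
  qed
  moreover have "B j = 0" if "j \<notin> {1..r}" for j unfolding B_def using that by (rule if_not_P)
  ultimately have "is_type_I I \<gamma> r w n B" unfolding is_type_I_iff using deg by blast
  then show ?thesis by (rule exI[of _ B])
qed

lemma type_I_unique:
  assumes B: "is_type_I I \<gamma> r w n B" and C: "is_type_I I \<gamma> r w n C"
  shows "B = C"
proof
  fix j
  show "B j = C j"
  proof (cases "j \<in> {1..r}")
    case True
    have "B j - C j = 0"
    proof (rule pairing_zero_imp_zero[OF _ _ True])
      show "coeff (B j - C j) i = 0" if "j \<in> {1..r}" "n j \<le> i" for j i
        using B C that by (simp add: is_type_I_iff)
      show "pairing (monom 1 k) (\<lambda>j. B j - C j) = 0" if "k < size n" for k
        using B C that by (simp add: is_type_I_iff pairing_diff_right)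
    qed
    then show ?thesis by simp
  next
    case False
    then show ?thesis using B C by (simp add: is_type_I_iff)
  qed
qed

lemma A_spec: "is_type_I I \<gamma> r w n (A n)"
  unfolding type_I_def by (rule theI'[OF ex_ex1I[OF type_I_exists type_I_unique]])

lemma A_coeff: "j \<in> {1..r} \<Longrightarrow> n j \<le> i \<Longrightarrow> coeff (A n j) i = 0"
  and A_pairing_monom: "k < size n \<Longrightarrow> pairing (monom 1 k) (A n) = (if Suc k = size n then 1 else 0)"
  using A_spec[of n] unfolding is_type_I_iff by blast+

text \<open>On polynomials of degree below |n|, integration against Q_n is the functional that
  extracts the coefficient of x^(|n|-1). The recurrence coefficients and the constants of the final
  computation are read off this way.\<close>

lemma A_pairing:
  assumes n: "size n = Suc k" and q: "\<And>i. i > k \<Longrightarrow> coeff q i = 0"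
  shows "pairing q (A n) = coeff q k"
proof -
  have "pairing q (A n) = (\<Sum>i<Suc k. coeff q i * pairing (monom 1 i) (A n))"
    by (rule pairing_expand) (simp add: q)
  also have "\<dots> = (\<Sum>i<Suc k. if i = k then coeff q i else 0)"
    by (rule sum.cong) (auto simp: A_pairing_monom n)
  finally show ?thesis by simp
qed

lemma A_pairing_low:
  assumes q: "\<And>i. Suc i \<ge> size n \<Longrightarrow> coeff q i = 0"
  shows "pairing q (A n) = 0"
proof (cases "size n")
  case 0
  \<comment> \<open>For |n| = 0 the hypothesis covers every index, so all coefficients
    vanish.\<close>
  then have "q = 0" using q by (intro poly_eqI) simp
  then show ?thesis by (simp add: pairing_def)
next
  case (Suc k)
  then show ?thesis using A_pairing[OF Suc, of q] q by simp
qed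

section \<open>Nearest-neighbor recurrences\<close>

lemma rec_a_eq: "j \<in> {1..r} \<Longrightarrow> a n j = h n j / h (down n j) j"
  by (simp add: rec_a_def h_def wint_def poly_monom down_def mult.commute mult.assoc mult.left_commute)

lemma rec_b_pairing: "b n j = pairing (pCons 0 (P n)) (A (up n j))"
proof -
  let ?f = "\<lambda>k t. poly (pCons 0 (P n) * A (up n j) k) t * w k t"
  have "b n j = curve_integral I \<gamma> (\<lambda>t. \<Sum>k=1..r. ?f k t)"
    by (simp add: rec_b_def type_I_Q_def sum_distrib_left mult.assoc)
  also have "\<dots> = (\<Sum>k=1..r. curve_integral I \<gamma> (?f k))"
    by (rule curve_integral_sum) (rule integrable)
  finally show ?thesis by (simp add: pairing_def wint_def)
qed

lemma pairing_P_up: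
  assumes j: "j \<in> {1..r}"
  shows "pairing (P (up n j)) (A (up n j)) = 0"
  unfolding pairing_def
proof (rule sum.neutral, rule ballI)
  fix k assume k: "k \<in> {1..r}"
  show "wint k (P (up n j) * A (up n j) k) = 0"
    by (rule wint_P_low[OF k]) (rule A_coeff[OF k])
qed

lemma P_up_coeff_top: "j \<in> {1..r} \<Longrightarrow> coeff (P (up n j)) (Suc (size n)) = 1"
  using P_coeff_top[of "up n j"] by (simp only: mi_size_up)

lemma P_up_coeff_above: "j \<in> {1..r} \<Longrightarrow> Suc (size n) < i \<Longrightarrow> coeff (P (up n j)) i = 0"
  by (rule P_coeff_above) (simp only: mi_size_up)

lemma coeff_xP_above: "Suc (size n) < i \<Longrightarrow> coeff (pCons 0 (P n)) i = 0"
  by (cases i) (simp_all add: P_coeff_above)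

text \<open>P_{n+e_j} integrates to 0 against Q_{n+e_j}, and subtracting it from x P_n lowers the
  degree to |n|; the pairing then extracts the coefficient of x^|n|.\<close>

lemma rec_b_eq:
  assumes j: "j \<in> {1..r}"
  shows "b n j = coeff (pCons 0 (P n)) (size n) - coeff (P (up n j)) (size n)"
proof -
  have top: "coeff (pCons 0 (P n) - P (up n j)) i = 0" if "i > size n" for i
    using that by (cases "i = Suc (size n)") (simp_all add: P_up_coeff_top[OF j] P_up_coeff_above[OF j] coeff_xP_above)
  have "b n j = pairing (pCons 0 (P n) - P (up n j)) (A (up n j))"
    by (simp add: rec_b_pairing pairing_diff_left pairing_P_up[OF j])
  also have "\<dots> = coeff (pCons 0 (P n) - P (up n j)) (size n)"
    by (rule A_pairing[OF mi_size_up[OF j] top])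
  finally show ?thesis by simp
qed

lemma up_apply: "j \<ge> 1 \<Longrightarrow> up n j k = (if k = j then Suc (n k) else n k)"
  by (simp add: up_def)

lemma down_apply: "j \<ge> 1 \<Longrightarrow> down n j k = (if k = j then n k - 1 else n k)"
  by (simp add: down_def)

text \<open>The two leading terms cancel and both polynomials satisfy the orthogonality conditions
  of n. By \<open>rec_b_eq\<close> the multiple of P_n removes the coefficient of x^|n|, and
  normality makes what is left zero.\<close>

lemma P_up_diff:
  assumes j: "j \<in> {1..r}" and l: "l \<in> {1..r}"
  shows "P (up n l) - P (up n j) = Polynomial.smult (b n j - b n l) (P n)"
proof -
  let ?q = "P (up n l) - P (up n j) - Polynomial.smult (b n j - b n l) (P n)"
  have "?q = 0"
  proof (rule orthogonal_imp_zero)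
    fix i assume i: "size n \<le> i"
    have "i = size n \<or> i = Suc (size n) \<or> i > Suc (size n)" using i by linarith
    then show "coeff ?q i = 0"
      by (elim disjE) (simp_all add: rec_b_eq[OF j] rec_b_eq[OF l] P_up_coeff_top[OF j] P_up_coeff_top[OF l]
        P_up_coeff_above[OF j] P_up_coeff_above[OF l] P_coeff_above)
  next
    fix k s assume k: "k \<in> {1..r}" "s < n k"
    have "s < up n l k" "s < up n j k" using k j l by (auto simp: up_apply)
    then show "wint k (?q * monom 1 s) = 0"
      using k by (simp only: left_diff_distrib wint_diff[OF k(1)] mult_smult_left wint_smult P_orth) simp
  qed
  then show ?thesis by simp
qed

text \<open>Otherwise P_n would satisfy all orthogonality conditions of n + e_j with a degree too
  small for that index, and normality would make it zero.\<close>

lemma h_nonzero: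
  assumes j: "j \<in> {1..r}"
  shows "h n j \<noteq> 0"
proof
  assume h: "h n j = 0"
  have "P n = 0"
  proof (rule orthogonal_imp_zero)
    show "coeff (P n) i = 0" if "size (up n j) \<le> i" for i
      using that j by (intro P_coeff_above) simp
    fix k s assume k: "k \<in> {1..r}" "s < up n j k"
    then show "wint k (P n * monom 1 s) = 0"
      using j h P_orth[OF k(1), of s n] by (cases "s < n k") (auto simp: up_apply h_def split: if_splits dest: less_antisym)
  qed
  then show False using P_coeff_top[of n] by (metis coeff_0 zero_neq_one)
qed

text \<open>Integrate \<open>P_up_diff\<close> against x^(n_j) w_j: P_{n+e_j} still has this
  orthogonality and drops out.\<close>

lemma h_up:
  assumes j: "j \<in> {1..r}" and l: "l \<in> {1..r}" and "j \<noteq> l"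
  shows "h (up n l) j = (b n j - b n l) * h n j"
proof -
  have "up n l j = n j" using assms by (simp add: up_apply)
  moreover have "wint j (P (up n j) * monom 1 (n j)) = 0"
    using j by (intro P_orth) (simp_all add: up_apply)
  moreover have "wint j ((P (up n l) - P (up n j)) * monom 1 (n j)) = (b n j - b n l) * h n j"
    by (simp only: P_up_diff[OF j l] mult_smult_left wint_smult h_def)
  ultimately show ?thesis
    by (simp add: h_def left_diff_distrib wint_diff[OF j])
qed

text \<open>The term with \<open>b n l\<close> lowers the degree of the difference below |n|.
  Against w_k, the polynomial x P_n can fail orthogonality only for the power x^(n_k - 1), and
  \<open>a n k\<close> is chosen to repair exactly this.\<close>

lemma P_recurrence:
  assumes l: "l \<in> {1..r}" and n: "\<And>j. j \<in> {1..r} \<Longrightarrow> n j \<ge> 1"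
  shows "pCons 0 (P n) = P (up n l) + Polynomial.smult (b n l) (P n) +
    (\<Sum>j=1..r. Polynomial.smult (a n j) (P (down n j)))"
proof -
  let ?S = "\<Sum>j=1..r. Polynomial.smult (a n j) (P (down n j))"
  let ?q = "pCons 0 (P n) - P (up n l) - Polynomial.smult (b n l) (P n) - ?S"
  have down: "size n = Suc (size (down n j))" if "j \<in> {1..r}" for j
    using mi_size_down n that by blast
  have "?q = 0"
  proof (rule orthogonal_imp_zero)
    fix i assume i: "size n \<le> i"
    have S: "coeff ?S i = 0"
      unfolding coeff_sum by (rule sum.neutral) (use i down in \<open>auto intro!: P_coeff_above\<close>)
    have "i = size n \<or> i = Suc (size n) \<or> i > Suc (size n)" using i by linarith
    then show "coeff ?q i = 0"
      unfolding coeff_diff S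
      by (elim disjE) (simp_all add: rec_b_eq[OF l] P_up_coeff_top[OF l] P_up_coeff_above[OF l] P_coeff_above coeff_xP_above)
  next
    fix k s assume k: "k \<in> {1..r}" and s: "s < n k"
    have up: "wint k (P (up n l) * monom 1 s) = 0"
      using k s l by (intro P_orth) (auto simp: up_apply)
    have x: "pCons 0 (P n) * monom 1 s = P n * monom 1 (Suc s)"
      by (simp add: monom_Suc mult_pCons_left mult_pCons_right)
    have "wint k (?S * monom 1 s) = (\<Sum>j=1..r. a n j * wint k (P (down n j) * monom 1 s))"
      by (simp add: sum_distrib_right wint_sum[OF k] wint_smult)
    also have "\<dots> = wint k (P n * monom 1 (Suc s))"
    proof (cases "Suc s < n k")
      case True
      have "wint k (P (down n j) * monom 1 s) = 0" if "j \<in> {1..r}" for j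
        using True that k by (intro P_orth) (auto simp: down_apply)
      then have "(\<Sum>j=1..r. a n j * wint k (P (down n j) * monom 1 s)) = 0"
        by (intro sum.neutral) simp
      then show ?thesis using P_orth[where n = n, OF k True] by simp
    next
      case False
      then have s': "n k = Suc s" using s by linarith
      \<comment> \<open>Only removing e_k relaxes the last condition for w_k, so a single term of
        the sum survives.\<close>
      have "wint k (P (down n j) * monom 1 s) = (if j = k then h (down n k) k else 0)" if "j \<in> {1..r}" for j
        using that k s P_orth[OF k, of s "down n j"] by (auto simp: h_def down_apply s')
      then have "(\<Sum>j=1..r. a n j * wint k (P (down n j) * monom 1 s)) =
        (\<Sum>j=1..r. if j = k then a n k * h (down n k) k else 0)"
        by (intro sum.cong) auto
      also have "\<dots> = a n k * h (down n k) k" using k by simp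
      also have "\<dots> = h n k" using h_nonzero[OF k] by (simp add: rec_a_eq[OF k])
      finally show ?thesis by (simp add: h_def s')
    qed
    finally show "wint k (?q * monom 1 s) = 0"
      by (simp only: left_diff_distrib wint_diff[OF k] mult_smult_left wint_smult up x P_orth[where n = n, OF k s]) simp
  qed
  then show ?thesis by (simp add: algebra_simps)
qed

text \<open>This is \<open>P_up_diff\<close> at n - e_j, where n_j \<ge> 1 keeps the subtraction
  from truncating.\<close>

lemma P_down_recurrence:
  assumes j: "j \<in> {1..r}" and l: "l \<in> {1..r}" and n: "n j \<ge> 1"
  shows "P (down (up n l) j) = P n + Polynomial.smult (b (down n j) j - b (down n j) l) (P (down n j))"
proof -
  have "down (up n l) j = up (down n j) l" using j l n by (auto simp: up_def down_def)
  moreover have "up (down n j) j = n" using j n by (intro up_down) simp_all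
  ultimately show ?thesis using P_up_diff[OF j l, of "down n j"] by (simp add: algebra_simps)
qed

text \<open>Write each \<open>a\<close> as a quotient of values of \<open>h\<close> and apply
  \<open>h_up\<close> at n and at n - e_j. The difference of \<open>b\<close> at n - e_j cancels: it
  is a factor of a nonzero value of \<open>h\<close>.\<close>

lemma rec_a_rec_b_compatible:
  assumes j: "j \<in> {1..r}" and l: "l \<in> {1..r}" and jl: "j \<noteq> l" and n: "n j \<ge> 1"
  shows "a (up n l) j * (b (down n j) j - b (down n j) l) = a n j * (b n j - b n l)"
proof -
  have "down (up n l) j = up (down n j) l" using j l n by (auto simp: up_def down_def)
  then show ?thesis
    using h_up[OF j l jl, of n] h_up[OF j l jl, of "down n j"] h_nonzero[OF j, of "up (down n j) l"]
    by (simp add: rec_a_eq[OF j])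
qed

text \<open>Both sides are \<open>\<integral> P\<^sub>n Q\<^bsub>n+e\<^sub>j\<^esub>\<close>.\<close>

lemma coeff_A_h:
  assumes j: "j \<in> {1..r}"
  shows "coeff (A (up n j) j) (n j) * h n j = 1"
proof -
  have "wint k (P n * A (up n j) k) = (if k = j then coeff (A (up n j) j) (n j) * h n j else 0)"
    if k: "k \<in> {1..r}" for k
  proof (cases "k = j")
    case True
    then show ?thesis using j by (simp add: wint_P_top[OF j] A_coeff up_apply)
  next
    case False
    have "wint k (P n * A (up n j) k) = 0"
      by (rule wint_P_low[OF k]) (use j k False in \<open>auto intro!: A_coeff simp: up_apply\<close>)
    then show ?thesis using False by simp
  qed
  then have "pairing (P n) (A (up n j)) = (\<Sum>k=1..r. if k = j then coeff (A (up n j) j) (n j) * h n j else 0)"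
    unfolding pairing_def by (intro sum.cong) simp_all
  also have "\<dots> = coeff (A (up n j) j) (n j) * h n j" using j by simp
  finally show ?thesis
    using A_pairing[of "up n j" "size n" "P n"] j by (simp add: P_coeff_above)
qed

text \<open>Once the lower powers are annihilated, the test with x^N may be replaced by a test with
  any monic polynomial of degree N, such as P_n or x P_n, whose pairing is known.\<close>

lemma pairing_monic_top:
  assumes q: "coeff q N = 1" "\<And>i. i > N \<Longrightarrow> coeff q i = 0"
    and low: "\<And>i. i < N \<Longrightarrow> pairing (monom 1 i) D = 0"
  shows "pairing (monom 1 N) D = pairing q D"
proof -
  have "pairing q D = (\<Sum>i<Suc N. coeff q i * pairing (monom 1 i) D)"
    by (rule pairing_expand) (simp add: q)
  then show ?thesis by (simp add: low q)
qed

text \<open>The difference \<open>D\<close> obeys the degree bounds of m = n + e_l + e_j, so |n| + 2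
  moments decide. In all but the last, the normalizations cancel. The last one, tested with x P_n,
  is \<open>rec_a_rec_b_compatible\<close>.\<close>

lemma A_shift_recurrence:
  assumes j: "j \<in> {1..r}" and l: "l \<in> {1..r}" and n: "n j \<ge> 1" and k: "k \<in> {1..r}"
  shows "Polynomial.smult (a n j) (A (up n j) k) = Polynomial.smult (a n j) (A (up n l) k) +
    Polynomial.smult (a (up n l) j * (b (down n j) j - b (down n j) l)) (A (up (up n l) j) k)"
proof (cases "j = l")
  case True
  then show ?thesis by simp
next
  case jl: False
  define m where "m = up (up n l) j"
  define c where "c = a (up n l) j * (b (down n j) j - b (down n j) l)"
  define D where "D = (\<lambda>k. Polynomial.smult (a n j) (A (up n j) k) - Polynomial.smult (a n j) (A (up n l) k) -
    Polynomial.smult c (A m k))"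
  have size_m: "size m = Suc (Suc (size n))" using j l by (simp add: m_def)
  have D: "pairing q D = a n j * pairing q (A (up n j)) - a n j * pairing q (A (up n l)) - c * pairing q (A m)" for q
    by (simp only: D_def pairing_diff_right pairing_smult_right)
  have low: "pairing (monom 1 i) D = 0" if "i < Suc (size n)" for i
    using that j l by (simp add: D A_pairing_monom size_m)
  have "D k = 0"
  proof (rule pairing_zero_imp_zero[OF _ _ k])
    show "coeff (D k) i = 0" if k: "k \<in> {1..r}" and i: "m k \<le> i" for k i
    proof -
      have "up n j k \<le> i" "up n l k \<le> i" using i j l by (auto simp: m_def up_apply split: if_splits)
      then show ?thesis using k i by (simp add: D_def A_coeff)
    qed
    fix i assume "i < size m"
    then have "i < Suc (size n) \<or> i = Suc (size n)" unfolding size_m by linarith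
    moreover have "pairing (monom 1 (Suc (size n))) D = 0"
    proof -
      have "pairing (pCons 0 (P n)) (A m) = 1"
        using A_pairing[OF size_m, of "pCons 0 (P n)"] coeff_xP_above by simp
      moreover have "pairing (monom 1 (Suc (size n))) D = pairing (pCons 0 (P n)) D"
        by (rule pairing_monic_top[OF _ coeff_xP_above low]) simp_all
      ultimately show ?thesis
        using rec_a_rec_b_compatible[where n = n, OF j l jl n]
        by (simp add: D flip: rec_b_pairing) (simp add: c_def algebra_simps)
    qed
    ultimately show "pairing (monom 1 i) D = 0" using low by blast
  qed
  then show ?thesis by (simp add: D_def m_def c_def algebra_simps)
qed

text \<open>With m = n + e_l, the difference \<open>E\<close> must be shown to obey the degree
  bounds of m and to have |n| + 1 vanishing moments. In component k, degree m_k is reached only by x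
  A_{m,k} and A_{m+e_k,k}, whose top terms must cancel.\<close>

lemma A_recurrence:
  assumes l: "l \<in> {1..r}" and n: "\<And>j. j \<in> {1..r} \<Longrightarrow> n j \<ge> 1" and k: "k \<in> {1..r}"
  shows "pCons 0 (A (up n l) k) = A n k + Polynomial.smult (b n l) (A (up n l) k) +
    (\<Sum>j=1..r. Polynomial.smult (a (up n l) j) (A (up (up n l) j) k))"
proof -
  define m where "m = up n l"
  define E where "E = (\<lambda>k. pCons 0 (A m k) - A n k - Polynomial.smult (b n l) (A m k) -
    (\<Sum>j=1..r. Polynomial.smult (a m j) (A (up m j) k)))"
  have size_m: "size m = Suc (size n)" using l by (simp add: m_def)
  have nm: "n k \<le> m k" for k using l by (simp add: m_def up_apply)
  have m1: "m k \<ge> 1" if "k \<in> {1..r}" for k using n[OF that] nm[of k] by linarith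
  have E: "pairing q E = pairing (pCons 0 q) (A m) - pairing q (A n) - b n l * pairing q (A m) -
    (\<Sum>j=1..r. a m j * pairing q (A (up m j)))" for q
    by (simp only: E_def pairing_diff_right pairing_smult_right pairing_sum_right pairing_pCons_right)
  have high: "pairing q (A (up m j)) = 0" if j: "j \<in> {1..r}" and q: "\<And>i. i > size n \<Longrightarrow> coeff q i = 0" for j q
    by (rule A_pairing_low) (rule q, use j size_m in simp)
  have low: "pairing (monom 1 i) E = 0" if i: "i < size n" for i
  proof -
    have "pairing (monom 1 i) (A (up m j)) = 0" if "j \<in> {1..r}" for j
      by (rule high[OF that]) (use i in simp)
    then have "(\<Sum>j=1..r. a m j * pairing (monom 1 i) (A (up m j))) = 0"
      by (intro sum.neutral) simp
    then show ?thesis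
      using i by (simp only: E monom_Suc[symmetric]) (simp add: A_pairing_monom size_m)
  qed
  have "E k = 0"
  proof (rule pairing_zero_imp_zero[OF _ _ k])
    fix k i assume k: "k \<in> {1..r}" and i: "m k \<le> i"
    have A: "coeff (A (up m j) k) i = (if j = k \<and> i = m k then coeff (A (up m k) k) (m k) else 0)"
      if "j \<in> {1..r}" for j
      using A_coeff[OF k, of "up m j" i] i that by (cases "k = j"; cases "i = m k") (auto simp: up_apply)
    have "coeff (\<Sum>j=1..r. Polynomial.smult (a m j) (A (up m j) k)) i =
      (\<Sum>j=1..r. if j = k then (if i = m k then a m k * coeff (A (up m k) k) (m k) else 0) else 0)"
      unfolding coeff_sum by (rule sum.cong) (auto simp: A)
    also have "\<dots> = (if i = m k then a m k * coeff (A (up m k) k) (m k) else 0)"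
      using k by simp
    finally have S: "coeff (\<Sum>j=1..r. Polynomial.smult (a m j) (A (up m j) k)) i =
      (if i = m k then a m k * coeff (A (up m k) k) (m k) else 0)" .
    \<comment> \<open>The leading coefficients of A_{m,k} and A_{m+e_k,k} are the reciprocals of
      \<open>h\<close> at m - e_k and at m, and \<open>a m k\<close> is the second of these values
      over the first.\<close>
    have x: "coeff (pCons 0 (A m k)) i = (if i = m k then a m k * coeff (A (up m k) k) (m k) else 0)"
    proof (cases "i = m k")
      case True
      have "up (down m k) k = m" "down m k k = m k - 1"
        using k m1[OF k] by (auto intro!: up_down simp: down_apply)
      then have lead: "coeff (A m k) (m k - 1) * h (down m k) k = 1"
        using coeff_A_h[OF k, of "down m k"] by simp
      have "coeff (pCons 0 (A m k)) i = coeff (A m k) (m k - 1)"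
        using True m1[OF k] by (cases "m k") simp_all
      also have "\<dots> = 1 / h (down m k) k"
        using lead h_nonzero[OF k, of "down m k"] by (simp add: field_simps)
      also have "\<dots> = a m k * coeff (A (up m k) k) (m k)"
        using coeff_A_h[OF k, of m] by (simp add: rec_a_eq[OF k] mult.commute)
      finally show ?thesis using True by simp
    next
      case False
      then obtain i' where "i = Suc i'" "m k \<le> i'" using i by (cases i) auto
      then show ?thesis using A_coeff[OF k, of m i'] False by simp
    qed
    have "coeff (A n k) i = 0" "coeff (A m k) i = 0"
      using i nm[of k] by (auto intro!: A_coeff[OF k])
    then show "coeff (E k) i = 0" unfolding E_def coeff_diff coeff_smult x S by simp
  next
    fix i assume "i < size m"
    then have "i < size n \<or> i = size n" unfolding size_m by linarith
    \<comment> \<open>Tested with P_n, the vector Q_n gives 0, Q_m gives 1 and x Q_m gives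
      \<open>b n l\<close>; the remaining vectors see too low a degree.\<close>
    moreover have "pairing (monom 1 (size n)) E = 0"
    proof -
      have "pairing (P n) (A n) = 0"
        unfolding pairing_def by (rule sum.neutral) (auto intro!: wint_P_low A_coeff)
      moreover have "pairing (P n) (A m) = 1"
        using A_pairing[OF size_m, of "P n"] P_coeff_above by simp
      moreover have "pairing (pCons 0 (P n)) (A m) = b n l" by (simp only: rec_b_pairing m_def)
      moreover have "(\<Sum>j=1..r. a m j * pairing (P n) (A (up m j))) = 0"
        by (rule sum.neutral) (simp add: high P_coeff_above)
      ultimately have "pairing (P n) E = 0" by (simp only: E) simp
      moreover have "pairing (monom 1 (size n)) E = pairing (P n) E"
        by (rule pairing_monic_top[OF P_coeff_top P_coeff_above low])
      ultimately show ?thesis by simp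
    qed
    ultimately show "pairing (monom 1 i) E = 0" using low by blast
  qed
  then show ?thesis by (simp add: E_def m_def algebra_simps)
qed

end

section \<open>Compatibility\<close>

lemma up_0 [simp]: "up n 0 = n" and down_0 [simp]: "down n 0 = n"
  by (simp_all add: up_def down_def)

lemma mult_mat_index:
  assumes "M \<in> carrier_mat p q" "N \<in> carrier_mat q s" "i < p" "j < s"
  shows "(M * N) $$ (i, j) = (\<Sum>c<q. M $$ (i, c) * N $$ (c, j))"
  using assms by (auto simp: scalar_prod_def lessThan_atLeast0 intro!: sum.cong)

locale ladder_weights = normal_weights +
  fixes v' :: "nat \<Rightarrow> complex \<Rightarrow> complex" and x :: complex
  assumes log_derivative_integrable:
      "k \<in> {1..r} \<Longrightarrow> curve_integrable I \<gamma> (\<lambda>t. poly p t * (v' k t * w k t))"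
    and log_derivative_integral:
      "k \<in> {1..r} \<Longrightarrow> curve_integral I \<gamma> (\<lambda>t. poly p t * (v' k t * w k t)) =
        curve_integral I \<gamma> (\<lambda>t. poly (pderiv p) t * w k t)"
begin

text \<open>At \<open>t = x\<close> the quotient in \<open>J\<close> is 0, which is harmless: \<open>(t - x) * ((v' k t - v' k x) / (t - x))\<close> is
  still \<open>v' k t - v' k x\<close>.\<close>

definition J :: "(nat \<Rightarrow> complex poly) \<Rightarrow> complex \<Rightarrow> complex" where
  "J B t = (\<Sum>k=1..r. poly (B k) t * ((v' k t - v' k x) / (t - x) * w k t))"

text \<open>The integral of \<open>J\<close> after multiplication by t - x: the denominator is gone,
  and the terms with v_k'(t) have been integrated by parts.\<close>

definition T :: "(nat \<Rightarrow> complex poly) \<Rightarrow> complex" where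
  "T B = (\<Sum>k=1..r. wint k (pderiv (B k)) - v' k x * wint k (B k))"

section \<open>The ladder kernel and its values on products of both types\<close>

lemma J_add: "J (\<lambda>k. B k + C k) = (\<lambda>t. J B t + J C t)"
  by (rule ext) (simp only: J_def poly_add distrib_right sum.distrib)

lemma J_smult: "J (\<lambda>k. Polynomial.smult c (B k)) = (\<lambda>t. c * J B t)"
  by (rule ext) (simp add: J_def sum_distrib_left mult.assoc)

lemma J_sum: "J (\<lambda>k. \<Sum>i\<in>S. f i k) = (\<lambda>t. \<Sum>i\<in>S. J (f i) t)"
  by (rule ext) (simp only: J_def poly_sum sum_distrib_right sum.swap[of _ S])

lemma J_linear:
  "curve_integrable I \<gamma> (J (\<lambda>k. [:- x, 1:] * B k))" (is ?int)
  "curve_integral I \<gamma> (J (\<lambda>k. [:- x, 1:] * B k)) = T B" (is ?val)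
proof -
  let ?f = "\<lambda>k t. poly (B k) t * (v' k t * w k t) + (- v' k x) * (poly (B k) t * w k t)"
  have eq: "J (\<lambda>k. [:- x, 1:] * B k) = (\<lambda>t. \<Sum>k=1..r. ?f k t)"
  proof
    fix t
    have "poly ([:- x, 1:] * B k) t * ((v' k t - v' k x) / (t - x) * w k t) = ?f k t" for k
      by (cases "t = x") (simp_all add: field_simps)
    then show "J (\<lambda>k. [:- x, 1:] * B k) t = (\<Sum>k=1..r. ?f k t)" by (simp only: J_def)
  qed
  have f: "curve_integrable I \<gamma> (?f k)" "curve_integral I \<gamma> (?f k) = wint k (pderiv (B k)) - v' k x * wint k (B k)"
    if k: "k \<in> {1..r}" for k
  proof -
    note i = log_derivative_integrable[OF k, of "B k"] curve_integrable_cmult[OF integrable[OF k], of "- v' k x" "B k"]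
    show "curve_integrable I \<gamma> (?f k)" by (rule curve_integrable_add[OF i])
    show "curve_integral I \<gamma> (?f k) = wint k (pderiv (B k)) - v' k x * wint k (B k)"
      unfolding curve_integral_add[OF i] log_derivative_integral[OF k] curve_integral_cmult wint_def by simp
  qed
  show ?int unfolding eq by (rule curve_integrable_sum) (rule f(1))
  have "curve_integral I \<gamma> (\<lambda>t. \<Sum>k=1..r. ?f k t) = (\<Sum>k=1..r. curve_integral I \<gamma> (?f k))"
    by (rule curve_integral_sum) (rule f(1))
  then show ?val unfolding eq T_def using f(2) by simp
qed

lemma T_smult: "T (\<lambda>k. Polynomial.smult c (B k)) = c * T B"
  by (simp add: T_def pderiv_smult wint_smult sum_distrib_left algebra_simps)

text \<open>The product rule separates three sums that orthogonality can evaluate: the derivative on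
  \<open>p\<close> is handled by type I conditions, the other two by type II conditions.\<close>

lemma T_mult:
  "T (\<lambda>k. p * B k) = pairing (pderiv p) B + (\<Sum>k=1..r. wint k (p * pderiv (B k))) -
    (\<Sum>k=1..r. v' k x * wint k (p * B k))"
  by (simp add: T_def pairing_def pderiv_mult wint_add sum.distrib sum_subtractf mult.commute)

lemma wint_P_pderiv:
  assumes k: "k \<in> {1..r}" and q: "\<And>i. n k < i \<Longrightarrow> coeff q i = 0"
  shows "wint k (P n * pderiv q) = 0"
  by (rule wint_P_low[OF k]) (simp add: coeff_pderiv q)

text \<open>All type II terms vanish, and Q_n extracts the leading coefficient |n| of P_n'. The
  increment of this value from n to n + e_l accounts for the derivative of \<open>W\<close>.\<close>

lemma T_P_A: "T (\<lambda>k. P n * A n k) = of_nat (size n)"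
proof -
  have "wint k (P n * pderiv (A n k)) = 0" if k: "k \<in> {1..r}" for k
    by (rule wint_P_pderiv[OF k]) (simp add: A_coeff[OF k])
  moreover have "wint k (P n * A n k) = 0" if k: "k \<in> {1..r}" for k
    by (rule wint_P_low[OF k]) (rule A_coeff[OF k])
  ultimately have "T (\<lambda>k. P n * A n k) = pairing (pderiv (P n)) (A n)" by (simp add: T_mult)
  also have "\<dots> = of_nat (size n)"
  proof (cases "size n")
    case 0
    have "pairing (pderiv (P n)) (A n) = 0"
      by (rule A_pairing_low) (simp add: 0 coeff_pderiv P_coeff_above)
    then show ?thesis by (simp add: 0)
  next
    case (Suc k)
    have "pairing (pderiv (P n)) (A n) = coeff (pderiv (P n)) k"
      by (rule A_pairing[OF Suc]) (simp add: Suc coeff_pderiv P_coeff_above)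
    then show ?thesis using P_coeff_top[of n] by (simp add: Suc coeff_pderiv)
  qed
  finally show ?thesis .
qed

text \<open>For k \<noteq> j the degree of A_{n+e_j,k} stays below n_k; for k = j only its leading
  coefficient counts, which \<open>coeff_A_h\<close> normalizes.\<close>

lemma wint_P_A_up:
  assumes j: "j \<in> {1..r}" and k: "k \<in> {1..r}"
  shows "wint k (P n * A (up n j) k) = (if k = j then 1 else 0)"
proof (cases "k = j")
  case True
  then show ?thesis using j coeff_A_h[OF j, of n] by (simp add: wint_P_top[OF j] A_coeff up_apply)
next
  case False
  have "wint k (P n * A (up n j) k) = 0"
    by (rule wint_P_low[OF k]) (use j k False in \<open>auto intro!: A_coeff simp: up_apply\<close>)
  then show ?thesis using False by simp
qed

text \<open>Differentiating either factor drops it below the relevant degree bound, so only the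
  value of v_j' at \<open>x\<close> remains. The diagonal term of the ladder matrix compensates
  it.\<close>

lemma T_P_A_up:
  assumes j: "j \<in> {1..r}"
  shows "T (\<lambda>k. P n * A (up n j) k) = - v' j x"
proof -
  have "wint k (P n * pderiv (A (up n j) k)) = 0" if k: "k \<in> {1..r}" for k
    by (rule wint_P_pderiv[OF k], rule A_coeff[OF k]) (use j in \<open>auto simp: up_apply\<close>)
  moreover have "pairing (pderiv (P n)) (A (up n j)) = 0"
    by (rule A_pairing_low) (use j in \<open>simp add: coeff_pderiv P_coeff_above\<close>)
  ultimately have "T (\<lambda>k. P n * A (up n j) k) = - (\<Sum>k=1..r. v' k x * wint k (P n * A (up n j) k))"
    by (simp add: T_mult)
  also have "(\<Sum>k=1..r. v' k x * wint k (P n * A (up n j) k)) = (\<Sum>k=1..r. if k = j then v' j x else 0)"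
    by (rule sum.cong) (simp_all add: wint_P_A_up[OF j])
  also have "\<dots> = v' j x" using j by simp
  finally show ?thesis .
qed

text \<open>The row vector \<open>\<alpha>\<^sub>n\<close>, with components \<open>j\<close>, each a vector indexed by \<open>k\<close>.\<close>

definition Al :: "(nat \<Rightarrow> nat) \<Rightarrow> nat \<Rightarrow> nat \<Rightarrow> complex poly" where
  "Al n j k = (if j = 0 then - A n k else Polynomial.smult (a n j) (A (up n j) k))"

definition Wx :: "(nat \<Rightarrow> nat) \<Rightarrow> nat \<Rightarrow> nat \<Rightarrow> nat \<Rightarrow> complex" where
  "Wx n l i j = (if i = 0 then (if j = 0 then x - b n l else - a n j)
       else if j = 0 then 1
       else if i = j then b (down n j) j - b (down n j) l
       else 0)"

definition D :: "nat \<Rightarrow> complex" where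
  "D i = (if i = 0 then 0 else v' i x)"

definition K :: "(nat \<Rightarrow> nat) \<Rightarrow> nat \<Rightarrow> nat \<Rightarrow> complex" where
  "K n i j = curve_integral I \<gamma> (J (\<lambda>k. P (down n i) * Al n j k))"

text \<open>The sign of -A_n turns the denominator x - t of column 0 into t - x, so that one kernel
  serves all columns.\<close>

lemma J_eq_ladder_integrand:
  "J (\<lambda>k. P (down n i) * Al n j k) =
    (\<lambda>t. (if j = 0 then 1 else a n j) * ladder_integrand I \<gamma> r w v' n x i j t)"
proof
  fix t
  have "(v' k t - v' k x) / (x - t) = - ((v' k t - v' k x) / (t - x))" for k
    by (simp add: minus_divide_right)
  then show "J (\<lambda>k. P (down n i) * Al n j k) t =
    (if j = 0 then 1 else a n j) * ladder_integrand I \<gamma> r w v' n x i j t"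
    by (cases "j = 0") (simp_all add: J_def Al_def ladder_integrand_def sum_distrib_left mult.assoc mult.left_commute)
qed

lemma J_integrable:
  assumes "ladder_integrals_converge I \<gamma> r w v' n x" "i \<le> r" "j \<le> r"
  shows "curve_integrable I \<gamma> (J (\<lambda>k. P (down n i) * Al n j k))"
  unfolding J_eq_ladder_integrand
  using assms by (intro curve_integrable_cmult) (simp add: ladder_integrals_converge_def)

section \<open>Entrywise form of the matrices and of the two recurrences\<close>

lemma ladder_matrix_index:
  assumes "i < r + 1" "j < r + 1"
  shows "ladder_matrix I \<gamma> r w v' n x $$ (i, j) = K n i j + (if i = j then D i else 0)"
  using assms unfolding K_def J_eq_ladder_integrand curve_integral_cmult
  by (simp add: ladder_matrix_def D_def)

lemma recurrence_matrix_index: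
  assumes "i < r + 1" "j < r + 1"
  shows "recurrence_matrix I \<gamma> r w n l x $$ (i, j) = Wx n l i j"
  using assms by (simp add: recurrence_matrix_def Wx_def)

lemma mat_deriv_recurrence_matrix_index:
  assumes "i < r + 1" "j < r + 1"
  shows "mat_deriv (recurrence_matrix I \<gamma> r w n l) x $$ (i, j) = (if i = 0 \<and> j = 0 then 1 else 0)"
proof -
  have "deriv (\<lambda>y. y - c) x = 1" for c :: complex
    by (rule DERIV_imp_deriv) (auto intro!: derivative_eq_intros)
  then show ?thesis
    using assms by (cases "i = 0"; cases "j = 0") (simp_all add: mat_deriv_def recurrence_matrix_def)
qed

lemma sum_0_upto_split: "(\<Sum>c<r + 1. f c) = f 0 + (\<Sum>c=1..r. f c)" for f :: "nat \<Rightarrow> 'z :: comm_monoid_add"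
proof -
  have "{..<r + 1} = insert 0 {1..r}" by auto
  then show ?thesis by simp
qed

text \<open>An identity of polynomials in t with the constant \<open>x\<close> in \<open>Wx\<close>;
  the factor t - x restores the variable in the corner entry.\<close>

lemma P_vector_recurrence:
  assumes l: "l \<in> {1..r}" and n: "\<And>j. j \<in> {1..r} \<Longrightarrow> n j \<ge> 1" and i: "i < r + 1"
  shows "P (down (up n l) i) = (\<Sum>c<r + 1. Polynomial.smult (Wx n l i c) (P (down n c))) +
    (if i = 0 then [:- x, 1:] * P n else 0)"
proof (cases "i = 0")
  case True
  have "pCons 0 (P n) = [:- x, 1:] * P n + Polynomial.smult x (P n)"
    by (simp add: mult_pCons_left)
  then have "P (up n l) = [:- x, 1:] * P n + Polynomial.smult (x - b n l) (P n) -
    (\<Sum>j=1..r. Polynomial.smult (a n j) (P (down n j)))"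
    using P_recurrence[OF l n] by (simp add: algebra_simps smult_diff_left)
  then show ?thesis using True
    unfolding sum_0_upto_split by (simp add: Wx_def sum_negf)
next
  case False
  then have i: "i \<in> {1..r}" using assms by simp
  have "(\<Sum>c=1..r. Polynomial.smult (Wx n l i c) (P (down n c))) =
    (\<Sum>c=1..r. if c = i then Polynomial.smult (b (down n i) i - b (down n i) l) (P (down n i)) else 0)"
    using False by (intro sum.cong) (auto simp: Wx_def)
  also have "\<dots> = Polynomial.smult (b (down n i) i - b (down n i) l) (P (down n i))" using i by simp
  finally show ?thesis
    unfolding sum_0_upto_split using False P_down_recurrence[where n = n, OF i l n[OF i]] by (simp add: Wx_def)
qed

text \<open>Column 0 of \<open>Wx\<close> encodes \<open>A_recurrence\<close>; the other columns
  encode \<open>A_shift_recurrence\<close>.\<close>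

lemma Al_recurrence:
  assumes l: "l \<in> {1..r}" and n: "\<And>j. j \<in> {1..r} \<Longrightarrow> n j \<ge> 1" and j: "j < r + 1" and k: "k \<in> {1..r}"
  shows "Al n j k = (\<Sum>c<r + 1. Polynomial.smult (Wx n l c j) (Al (up n l) c k)) +
    (if j = 0 then [:- x, 1:] * Al (up n l) 0 k else 0)"
proof (cases "j = 0")
  case True
  have "pCons 0 (A (up n l) k) = [:- x, 1:] * A (up n l) k + Polynomial.smult x (A (up n l) k)"
    by (simp add: mult_pCons_left)
  then have "- A n k = - ([:- x, 1:] * A (up n l) k) - Polynomial.smult (x - b n l) (A (up n l) k) +
    (\<Sum>j=1..r. Polynomial.smult (a (up n l) j) (A (up (up n l) j) k))"
    using A_recurrence[OF l n k] by (simp add: algebra_simps smult_diff_left)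
  moreover have "(\<Sum>c=1..r. Polynomial.smult (Wx n l c 0) (Al (up n l) c k)) =
    (\<Sum>j=1..r. Polynomial.smult (a (up n l) j) (A (up (up n l) j) k))"
    by (rule sum.cong) (auto simp: Wx_def Al_def)
  ultimately show ?thesis using True
    unfolding sum_0_upto_split by (simp add: Wx_def Al_def)
next
  case False
  then have j: "j \<in> {1..r}" using assms by simp
  have "(\<Sum>c=1..r. Polynomial.smult (Wx n l c j) (Al (up n l) c k)) =
    (\<Sum>c=1..r. if c = j then Polynomial.smult (a (up n l) j * (b (down n j) j - b (down n j) l)) (A (up (up n l) j) k) else 0)"
    using False by (intro sum.cong) (auto simp: Wx_def Al_def mult.commute)
  also have "\<dots> = Polynomial.smult (a (up n l) j * (b (down n j) j - b (down n j) l)) (A (up (up n l) j) k)"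
    using j by simp
  finally show ?thesis
    unfolding sum_0_upto_split using False A_shift_recurrence[where n = n, OF j l n[OF j] k] by (simp add: Wx_def Al_def)
qed

lemma J_cong: "(\<And>k. k \<in> {1..r} \<Longrightarrow> B k = C k) \<Longrightarrow> J B = J C"
  unfolding J_def by (rule ext, rule sum.cong) simp_all

text \<open>The kernel of P_{m-e_i} times component j of \<alpha>_n, with m = n + e_l, is integrated
  in two ways. Expanding the second factor gives entries at m, expanding the first gives entries at
  n. Its integrability follows from these expansions.\<close>

lemma ladder_entry_identity:
  assumes l: "l \<in> {1..r}" and n: "\<And>j. j \<in> {1..r} \<Longrightarrow> n j \<ge> 1" and i: "i < r + 1" and j: "j < r + 1"
    and conv: "ladder_integrals_converge I \<gamma> r w v' n x" "ladder_integrals_converge I \<gamma> r w v' (up n l) x"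
  shows "(\<Sum>c<r + 1. K (up n l) i c * Wx n l c j) + (if j = 0 then T (\<lambda>k. P (down (up n l) i) * Al (up n l) 0 k) else 0) =
    (\<Sum>c<r + 1. Wx n l i c * K n c j) + (if i = 0 then T (\<lambda>k. P n * Al n j k) else 0)"
proof -
  define m where "m = up n l"
  define R where "R = (\<lambda>c k. P (down m i) * Al m c k)"
  define L where "L = (\<lambda>c k. P (down n c) * Al n j k)"
  have R: "curve_integrable I \<gamma> (J (R c))" if "c < r + 1" for c
    unfolding R_def m_def using conv(2) i that by (intro J_integrable) simp_all
  have L: "curve_integrable I \<gamma> (J (L c))" if "c < r + 1" for c
    unfolding L_def using conv(1) j that by (intro J_integrable) simp_all
  have Rint: "curve_integrable I \<gamma> (\<lambda>t. \<Sum>c<r + 1. Wx n l c j * J (R c) t)"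
    by (intro curve_integrable_sum curve_integrable_cmult R) simp
  have "curve_integral I \<gamma> (\<lambda>t. \<Sum>c<r + 1. Wx n l c j * J (R c) t) =
    (\<Sum>c<r + 1. curve_integral I \<gamma> (\<lambda>t. Wx n l c j * J (R c) t))"
    by (rule curve_integral_sum, rule curve_integrable_cmult, rule R) simp
  also have "\<dots> = (\<Sum>c<r + 1. K m i c * Wx n l c j)"
    by (rule sum.cong) (simp_all add: curve_integral_cmult K_def R_def mult.commute)
  finally have Rval: "curve_integral I \<gamma> (\<lambda>t. \<Sum>c<r + 1. Wx n l c j * J (R c) t) =
    (\<Sum>c<r + 1. K m i c * Wx n l c j)" .
  have Lint: "curve_integrable I \<gamma> (\<lambda>t. \<Sum>c<r + 1. Wx n l i c * J (L c) t)"
    by (intro curve_integrable_sum curve_integrable_cmult L) simp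
  have "curve_integral I \<gamma> (\<lambda>t. \<Sum>c<r + 1. Wx n l i c * J (L c) t) =
    (\<Sum>c<r + 1. curve_integral I \<gamma> (\<lambda>t. Wx n l i c * J (L c) t))"
    by (rule curve_integral_sum, rule curve_integrable_cmult, rule L) simp
  also have "\<dots> = (\<Sum>c<r + 1. Wx n l i c * K n c j)"
    by (rule sum.cong) (simp_all add: curve_integral_cmult K_def L_def mult.commute)
  finally have Lval: "curve_integral I \<gamma> (\<lambda>t. \<Sum>c<r + 1. Wx n l i c * J (L c) t) =
    (\<Sum>c<r + 1. Wx n l i c * K n c j)" .
  let ?E = "\<lambda>k. if j = 0 then [:- x, 1:] * R 0 k else 0"
  let ?F = "\<lambda>k. if i = 0 then [:- x, 1:] * L 0 k else 0"
  have J0: "J (\<lambda>k. 0) = (\<lambda>t. 0)" by (rule ext) (simp add: J_def)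
  have E: "curve_integrable I \<gamma> (J ?E)" "curve_integral I \<gamma> (J ?E) = (if j = 0 then T (R 0) else 0)"
    using J_linear[of "R 0"] by (cases "j = 0"; simp add: J0)+
  have F: "curve_integrable I \<gamma> (J ?F)" "curve_integral I \<gamma> (J ?F) = (if i = 0 then T (L 0) else 0)"
    using J_linear[of "L 0"] by (cases "i = 0"; simp add: J0)+
  have "J (\<lambda>k. P (down m i) * Al n j k) =
    J (\<lambda>k. (\<Sum>c<r + 1. Polynomial.smult (Wx n l c j) (R c k)) + ?E k)"
    by (rule J_cong, subst Al_recurrence[OF l n j])
      (simp_all add: R_def m_def ring_distribs sum_distrib_left mult.left_commute)
  also have "\<dots> = (\<lambda>t. (\<Sum>c<r + 1. Wx n l c j * J (R c) t) + J ?E t)"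
    by (simp only: J_add J_sum J_smult)
  finally have 1: "J (\<lambda>k. P (down m i) * Al n j k) = (\<lambda>t. (\<Sum>c<r + 1. Wx n l c j * J (R c) t) + J ?E t)" .
  have "J (\<lambda>k. P (down m i) * Al n j k) =
    J (\<lambda>k. (\<Sum>c<r + 1. Polynomial.smult (Wx n l i c) (L c k)) + ?F k)"
    unfolding m_def by (rule J_cong, subst P_vector_recurrence[OF l n i])
      (simp_all add: L_def ring_distribs sum_distrib_right mult.assoc)
  also have "\<dots> = (\<lambda>t. (\<Sum>c<r + 1. Wx n l i c * J (L c) t) + J ?F t)"
    by (simp only: J_add J_sum J_smult)
  finally have 2: "J (\<lambda>k. P (down m i) * Al n j k) = (\<lambda>t. (\<Sum>c<r + 1. Wx n l i c * J (L c) t) + J ?F t)" .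
  have "(\<Sum>c<r + 1. K m i c * Wx n l c j) + (if j = 0 then T (R 0) else 0) =
    curve_integral I \<gamma> (J (\<lambda>k. P (down m i) * Al n j k))"
    unfolding 1 by (simp only: curve_integral_add[OF Rint E(1)] Rval E(2))
  also have "\<dots> = (\<Sum>c<r + 1. Wx n l i c * K n c j) + (if i = 0 then T (L 0) else 0)"
    unfolding 2 by (simp only: curve_integral_add[OF Lint F(1)] Lval F(2))
  finally show ?thesis unfolding R_def L_def m_def down_0 .
qed

lemma ladder_compatibility:
  assumes l: "l \<in> {1..r}" and n: "\<And>j. j \<in> {1..r} \<Longrightarrow> n j \<ge> 1"
    and conv: "ladder_integrals_converge I \<gamma> r w v' n x" "ladder_integrals_converge I \<gamma> r w v' (up n l) x"
  shows "ladder_matrix I \<gamma> r w v' (up n l) x * recurrence_matrix I \<gamma> r w n l x =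
         mat_deriv (recurrence_matrix I \<gamma> r w n l) x +
         recurrence_matrix I \<gamma> r w n l x * ladder_matrix I \<gamma> r w v' n x"
    (is "?N' * ?W = ?W' + ?W * ?N")
proof (rule eq_matI)
  have N': "?N' \<in> carrier_mat (r + 1) (r + 1)" and N: "?N \<in> carrier_mat (r + 1) (r + 1)"
    by (simp_all add: ladder_matrix_def)
  have W: "?W \<in> carrier_mat (r + 1) (r + 1)" and W': "?W' \<in> carrier_mat (r + 1) (r + 1)"
    by (simp_all add: recurrence_matrix_def mat_deriv_def)
  note dims = N N' W W'
  show "dim_row (?N' * ?W) = dim_row (?W' + ?W * ?N)" "dim_col (?N' * ?W) = dim_col (?W' + ?W * ?N)"
    using dims by auto
  fix i j assume "i < dim_row (?W' + ?W * ?N)" "j < dim_col (?W' + ?W * ?N)"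
  then have i: "i < r + 1" and j: "j < r + 1" using dims by auto
  have "(?N' * ?W) $$ (i, j) = (\<Sum>c<r + 1. (K (up n l) i c + (if i = c then D i else 0)) * Wx n l c j)"
    using i j by (subst mult_mat_index[OF N' W i j])
      (auto intro!: sum.cong simp: ladder_matrix_index recurrence_matrix_index)
  also have "\<dots> = (\<Sum>c<r + 1. K (up n l) i c * Wx n l c j) + (\<Sum>c<r + 1. if i = c then D i * Wx n l i j else 0)"
    unfolding sum.distrib[symmetric] by (rule sum.cong) (auto simp: ring_distribs)
  also have "(\<Sum>c<r + 1. if i = c then D i * Wx n l i j else 0) = D i * Wx n l i j"
    using i by simp
  finally have lhs: "(?N' * ?W) $$ (i, j) = (\<Sum>c<r + 1. K (up n l) i c * Wx n l c j) + D i * Wx n l i j" .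
  have "(?W * ?N) $$ (i, j) = (\<Sum>c<r + 1. Wx n l i c * (K n c j + (if c = j then D c else 0)))"
    using i j by (subst mult_mat_index[OF W N i j])
      (auto intro!: sum.cong simp: ladder_matrix_index recurrence_matrix_index)
  also have "\<dots> = (\<Sum>c<r + 1. Wx n l i c * K n c j) + (\<Sum>c<r + 1. if c = j then Wx n l i j * D j else 0)"
    unfolding sum.distrib[symmetric] by (rule sum.cong) (auto simp: ring_distribs)
  also have "(\<Sum>c<r + 1. if c = j then Wx n l i j * D j else 0) = Wx n l i j * D j"
    using j by simp
  finally have rhs: "(?W * ?N) $$ (i, j) = (\<Sum>c<r + 1. Wx n l i c * K n c j) + Wx n l i j * D j" .
  have neg: "T (\<lambda>k. - B k) = - T B" for B
    using T_smult[of "- 1" B] by simp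
  \<comment> \<open>For i \<ge> 1 the index m = n + e_l is regarded as (m - e_i) + e_i, so that
    \<open>T_P_A_up\<close> applies at m - e_i.\<close>
  have T1: "T (\<lambda>k. P (down (up n l) i) * Al (up n l) 0 k) = (if i = 0 then - of_nat (Suc (size n)) else D i)"
  proof (cases "i = 0")
    case True
    then show ?thesis using T_P_A[of "up n l"] l by (simp add: Al_def neg)
  next
    case False
    then have i': "i \<in> {1..r}" using i by simp
    have "up n l i \<ge> 1" using n[OF i'] l by (auto simp: up_apply)
    then have "up (down (up n l) i) i = up n l" using i' by (intro up_down) simp_all
    then show ?thesis using T_P_A_up[OF i', of "down (up n l) i"] False by (simp add: Al_def neg D_def)
  qed
  have T2: "T (\<lambda>k. P n * Al n j k) = (if j = 0 then - of_nat (size n) else - (a n j * D j))"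
  proof (cases "j = 0")
    case True
    then show ?thesis using T_P_A[of n] by (simp add: Al_def neg)
  next
    case False
    then have j': "j \<in> {1..r}" using j by simp
    then show ?thesis using T_P_A_up[OF j', of n] False T_smult[of "a n j" "\<lambda>k. P n * A (up n j) k"]
      by (simp add: Al_def D_def)
  qed
  \<comment> \<open>In the corner the sizes differ by 1, which is the derivative of
    \<open>W\<close>. In the rest of column 0 and row 0 the leftovers are the diagonal contributions
    \<open>D i\<close> and \<open>a n j * D j\<close>. In the remaining block \<open>Wx\<close> is
    diagonal and commutes with \<open>D\<close>.\<close>
  have "(\<Sum>c<r + 1. K (up n l) i c * Wx n l c j) + D i * Wx n l i j =
    (if i = 0 \<and> j = 0 then 1 else 0) + ((\<Sum>c<r + 1. Wx n l i c * K n c j) + Wx n l i j * D j)"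
    using ladder_entry_identity[OF l n i j conv] unfolding T1 T2
    by (cases "i = 0"; cases "j = 0") (auto simp: Wx_def D_def algebra_simps)
  then show "(?N' * ?W) $$ (i, j) = (?W' + ?W * ?N) $$ (i, j)"
    using dims i j by (simp add: lhs rhs mat_deriv_recurrence_matrix_index)
qed

end

theorem theorem2p3:
  fixes I :: "real set" and \<gamma> :: "real \<Rightarrow> complex" and r :: nat
    and w v' :: "nat \<Rightarrow> complex \<Rightarrow> complex"
    and n :: "nat \<Rightarrow> nat" and l :: nat and x :: complex
  assumes curve: "oriented_simple_curve I \<gamma>"
    and r: "r \<ge> 1"
    and weights: "\<And>k. k \<in> {1..r} \<Longrightarrow> regular_weight I \<gamma> (w k)"
    and vanish: "\<And>k. k \<in> {1..r} \<Longrightarrow> vanishes_at_endpoints I \<gamma> (w k)"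
    and v': "\<And>k t. k \<in> {1..r} \<Longrightarrow> t \<in> \<gamma> ` I \<Longrightarrow> w k t \<noteq> 0 \<Longrightarrow>
               v' k t = - deriv_along (\<gamma> ` I) (w k) t / w k t"
    and normal: "\<And>m. normal_index I \<gamma> r w m"
    and indep: "\<And>m. weights_lin_indep (\<gamma> ` I) r w m"
    and n: "\<And>j. j \<in> {1..r} \<Longrightarrow> n j \<ge> 1"
    and l: "l \<in> {1..r}"
    and conv: "ladder_integrals_converge I \<gamma> r w v' n x"
      "ladder_integrals_converge I \<gamma> r w v' (up n l) x"
  shows "ladder_matrix I \<gamma> r w v' (up n l) x * recurrence_matrix I \<gamma> r w n l x =
         mat_deriv (recurrence_matrix I \<gamma> r w n l) x +
         recurrence_matrix I \<gamma> r w n l x * ladder_matrix I \<gamma> r w v' n x"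
proof -
  interpret ladder_weights I \<gamma> r w v' x
  proof
    show "curve_integrable I \<gamma> (\<lambda>t. poly p t * w k t)" if "k \<in> {1..r}" for k p
      by (rule regular_weight_poly_integrable(1)[OF weights[OF that]])
    show "normal_index I \<gamma> r w m" for m by (rule normal)
    show "curve_integrable I \<gamma> (\<lambda>t. poly p t * (v' k t * w k t))"
      "curve_integral I \<gamma> (\<lambda>t. poly p t * (v' k t * w k t)) =
        curve_integral I \<gamma> (\<lambda>t. poly (pderiv p) t * w k t)" if "k \<in> {1..r}" for k p
      using curve_integral_log_derivative[OF curve weights[OF that] vanish[OF that], of "v' k"] v'[OF that]
      by blast+
  qed
  show ?thesis using l n conv by (rule ladder_compatibility)
qed

end
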